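(* Let $n,d\in\mathbb{N}$, let $U\subseteq F^d$ be open, and let $\mathbf{f}=(f_1,\dots,f_n): U\to F^n$ be a map which is $(C,\alpha_0)$-good on $U$ with respect to $\lambda$ for some $C,\alpha_0>0$. Assume that $(\mathbf{f},\lambda)$ is nonplanar. Then, for every $\theta\in F$, for $\lambda$-almost every $\mathbf{x}\in U$, $$\omega(\mathbf{f}(\mathbf{x}),\theta)\ge 1.$$ (The exceptional null set may depend on $\theta$.)
   Context: Let $p$ be a prime, $q=p^r$ with $r\in\mathbb{N}$, $\Lambda=\mathbb{F}_q[T]$ and $F=\mathbb{F}_q((T^{-1}))$, the field of Laurent series in $T^{-1}$ over $\mathbb{F}_q$. For nonzero $a=\sum_{k\le k_0}a_kT^k\in F$ with $a_k\in\mathbb{F}_q$ and $a_{k_0}\ne 0$, put $|a|=e^{k_0}$, and $|0|=0$. This is a non-archimedean absolute value on $F$. The space $F^d$ carries the supremum norm $\|\mathbf{x}\|=\max_{1\le i\le d}|x_i|$ and the induced metric and topology. $\lambda$ denotes the Haar measure on $F^d$ giving measure $1$ to the closed unit ball $\{\|\mathbf{x}\|\le 1\}$. Exponent. For $\mathbf{y}\in F^n$ (viewed as a single linear form, i.e. a $1\times n$ matrix) and $\theta\in F$, the inhomogeneous exponent $\omega(\mathbf{y},\theta)$ is the supremum (possibly $+\infty$) of the real numbers $\omega$ for which, for arbitrarily large $t\in\mathbb{N}$, the inequalities $$|\mathbf{y}\cdot\mathbf{q}-p_0-\theta|<e^{-n\omega t},\qquad \|\mathbf{q}\|<e^{t}$$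 have a solution $(p_0,\mathbf{q})\in\Lambda\times(\Lambda^n\setminus\{\mathbf{0}\})$, where $\mathbf{y}\cdot\mathbf{q}=\sum_{i=1}^n y_iq_i$. Good maps. A function $g:U\to F$ with $|g|$ measurable is $(C,\alpha)$-good on $U$ with respect to $\lambda$ if for every ball $B\subseteq U$ and every $\varepsilon>0$, $$\lambda(\{\mathbf{x}\in B:|g(\mathbf{x})|<\varepsilon\})\le C\left(\frac{\varepsilon}{\sup_{\mathbf{x}\in B}|g(\mathbf{x})|}\right)^{\alpha}\lambda(B)$$ (the condition being vacuous when the supremum is $0$). The map $\mathbf{f}=(f_1,\dots,f_n)$ is $(C,\alpha)$-good on $U$ with respect to $\lambda$ if every $F$-linear combination of $1,f_1,\dots,f_n$ is $(C,\alpha)$-good on $U$ with respect to $\lambda$. Nonplanarity. $(\mathbf{f},\lambda)$ is nonplanar at $\mathbf{x}_0\in U$ if for every ball $B\subseteq U$ centered at $\mathbf{x}_0$ the restrictions of $1,f_1,\dots,f_n$ to $B$ are linearly independent over $F$. $(\mathbf{f},\lambda)$ is nonplanar if it is nonplanar at $\lambda$-almost every point of $U$. *)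

theory Defs
  imports
    "HOL-Analysis.Analysis"
    "HOL-Computational_Algebra.Polynomial"
    "HOL-Computational_Algebra.Formal_Laurent_Series"
begin

text \<open>
  A finite field \<open>\<bbbF>\<^sub>q\<close> is a type \<open>'k :: {field, finite}\<close>. The local field
  \<open>F = \<bbbF>\<^sub>q((T\<^sup>-\<^sup>1))\<close> is \<open>'k fls\<close>, where the formal variable \<^const>\<open>fls_X\<close> stands for
  \<open>T\<^sup>-\<^sup>1\<close>; hence \<open>T\<close> is \<^const>\<open>fls_X_inv\<close> and the leading exponent \<open>k\<^sub>0\<close> of a nonzero
  series in powers of \<open>T\<close> is minus its \<^const>\<open>fls_subdegree\<close>.
\<close>

definition fabs :: "'k::{field,finite} fls \<Rightarrow> real" where
  "fabs a = (if a = 0 then 0 else exp (- real_of_int (fls_subdegree a)))"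

text \<open>The inclusion of \<open>\<Lambda> = \<bbbF>\<^sub>q[T]\<close> into \<open>F\<close>: evaluation of a polynomial at \<open>T\<close>.\<close>

definition of_poly :: "'k::{field,finite} poly \<Rightarrow> 'k fls" where
  "of_poly p = poly (map_poly fls_const p) fls_X_inv"

definition of_poly_vec :: "('k::{field,finite} poly) ^ 'n \<Rightarrow> ('k fls) ^ 'n" where
  "of_poly_vec q = (\<chi> i. of_poly (q $ i))"

definition supnorm :: "('k::{field,finite} fls) ^ 'd \<Rightarrow> real" where
  "supnorm x = Max (range (\<lambda>i. fabs (x $ i)))"

text \<open>
  The library metric on \<^typ>\<open>('k::{field,finite} fls) ^ 'd\<close> is a Euclidean combination of metrics
  with base 2, so its balls are not those of \<^const>\<open>supnorm\<close>, although the topologies agree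
  (lemma \<open>open_iff_supball\<close> below). As \<^const>\<open>fabs\<close> takes discrete nonzero values, open and closed
  balls of positive radius form the same family of sets.
\<close>

definition supball :: "('k::{field,finite} fls) ^ 'd \<Rightarrow> real \<Rightarrow> (('k fls) ^ 'd) set" where
  "supball x r = {y. supnorm (y - x) < r}"

text \<open>
  Haar measure on \<open>F\<^sup>d\<close>, written \<open>\<mu>\<close> since \<open>\<lambda>\<close> is reserved, as a measure on the Borel sets, normalised on the closed unit ball.
\<close>

definition is_haar :: "(('k::{field,finite} fls) ^ 'd) measure \<Rightarrow> bool" where
  "is_haar \<mu> \<longleftrightarrow>
     sets \<mu> = sets borel \<and>
     (\<forall>a. \<forall>A\<in>sets borel. emeasure \<mu> ((\<lambda>x. a + x) ` A) = emeasure \<mu> A) \<and>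
     emeasure \<mu> {x. supnorm x \<le> 1} = 1"

definition dotp :: "('k::{field,finite} fls) ^ 'n \<Rightarrow> ('k fls) ^ 'n \<Rightarrow> 'k fls" where
  "dotp y z = (\<Sum>i\<in>UNIV. y $ i * z $ i)"

definition inhom_exponent :: "('k::{field,finite} fls) ^ 'n \<Rightarrow> 'k fls \<Rightarrow> ereal" where
  "inhom_exponent y \<theta> =
     Sup {ereal \<omega> | \<omega> :: real. \<exists>\<^sub>F t :: nat in sequentially.
       \<exists>(p0 :: 'k poly) (q :: 'k poly ^ 'n). q \<noteq> 0 \<and>
         fabs (dotp y (of_poly_vec q) - of_poly p0 - \<theta>) < exp (- (real CARD('n) * \<omega> * real t)) \<and>
         supnorm (of_poly_vec q) < exp (real t)}"

text \<open>
  Measurability is understood with respect to the completion of \<open>\<mu>\<close>. The supremum is taken in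
  \<^typ>\<open>ennreal\<close>; if it is infinite, the quotient and hence the right-hand side is \<open>0\<close>.
\<close>

definition good_fun ::
  "(('k::{field,finite} fls) ^ 'd) measure \<Rightarrow> real \<Rightarrow> real \<Rightarrow> (('k fls) ^ 'd) set
    \<Rightarrow> (('k fls) ^ 'd \<Rightarrow> 'k fls) \<Rightarrow> bool" where
  "good_fun \<mu> C \<alpha> U g \<longleftrightarrow>
     (\<lambda>x. fabs (g x)) \<in> borel_measurable (restrict_space (completion \<mu>) U) \<and>
     (\<forall>x0 r \<epsilon>. r > 0 \<and> supball x0 r \<subseteq> U \<and> \<epsilon> > 0 \<longrightarrow>
        (let B = supball x0 r; s = (SUP x\<in>B. ennreal (fabs (g x))) in
          s \<noteq> 0 \<longrightarrow>
          emeasure (completion \<mu>) {x\<in>B. fabs (g x) < \<epsilon>}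
            \<le> ennreal (C * enn2real (ennreal \<epsilon> / s) powr \<alpha>) * emeasure \<mu> B))"

definition affine_comb ::
  "'k::{field,finite} fls \<Rightarrow> ('k fls) ^ 'n \<Rightarrow> ('x \<Rightarrow> ('k fls) ^ 'n) \<Rightarrow> 'x \<Rightarrow> 'k fls" where
  "affine_comb c0 c f x = c0 + (\<Sum>i\<in>UNIV. c $ i * f x $ i)"

definition good_map ::
  "(('k::{field,finite} fls) ^ 'd) measure \<Rightarrow> real \<Rightarrow> real \<Rightarrow> (('k fls) ^ 'd) set
    \<Rightarrow> (('k fls) ^ 'd \<Rightarrow> ('k fls) ^ 'n) \<Rightarrow> bool" where
  "good_map \<mu> C \<alpha> U f \<longleftrightarrow> (\<forall>c0 c. good_fun \<mu> C \<alpha> U (affine_comb c0 c f))"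

definition nonplanar_at ::
  "(('k::{field,finite} fls) ^ 'd) set \<Rightarrow> (('k fls) ^ 'd \<Rightarrow> ('k fls) ^ 'n)
    \<Rightarrow> ('k fls) ^ 'd \<Rightarrow> bool" where
  "nonplanar_at U f x0 \<longleftrightarrow>
     (\<forall>r>0. supball x0 r \<subseteq> U \<longrightarrow>
        (\<forall>c0 c. (\<forall>x\<in>supball x0 r. affine_comb c0 c f x = 0) \<longrightarrow> c0 = 0 \<and> c = 0))"

definition nonplanar ::
  "(('k::{field,finite} fls) ^ 'd) measure \<Rightarrow> (('k fls) ^ 'd) set
    \<Rightarrow> (('k fls) ^ 'd \<Rightarrow> ('k fls) ^ 'n) \<Rightarrow> bool" where
  "nonplanar \<mu> U f \<longleftrightarrow> (AE x in \<mu>. x \<in> U \<longrightarrow> nonplanar_at U f x)"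

lemma fabs_less_iff_dist:
  fixes a b :: "'k::{field,finite} fls"
  shows "fabs (a - b) < exp (- real m) \<longleftrightarrow> dist a b < inverse (2 ^ m)"
proof (cases "a = b")
  case True
  then show ?thesis by (simp add: fabs_def)
next
  case ab: False
  have L: "fabs (a - b) < exp (- real m) \<longleftrightarrow> fls_subdegree (a - b) > int m"
    using ab by (simp add: fabs_def) linarith
  show ?thesis
  proof (cases "fls_subdegree (a - b) \<ge> 0")
    case True
    then have "dist a b < inverse (2 ^ m) \<longleftrightarrow> m < nat (fls_subdegree (a - b))"
      using ab by (simp add: dist_fls_def)
    then show ?thesis using L True by linarith
  next
    case False
    have "inverse (2 ^ m) \<le> (1 :: real)"
      by (simp add: inverse_le_1_iff)
    also have "\<dots> \<le> dist a b"
      using ab False by (simp add: dist_fls_def)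
    finally show ?thesis using L False by auto
  qed
qed

lemma supnorm_less_iff: "supnorm x < r \<longleftrightarrow> (\<forall>i. fabs (x $ i) < r)"
  unfolding supnorm_def by (subst Max_less_iff) auto

lemma open_iff_supball:
  fixes U :: "(('k::{field,finite} fls) ^ 'd) set"
  shows "open U \<longleftrightarrow> (\<forall>x\<in>U. \<exists>r>0. supball x r \<subseteq> U)"
proof
  assume U: "open U"
  show "\<forall>x\<in>U. \<exists>r>0. supball x r \<subseteq> U"
  proof
    fix x assume "x \<in> U"
    with U obtain e where e: "e > 0" "\<And>y. dist y x < e \<Longrightarrow> y \<in> U"
      unfolding open_dist by blast
    obtain m where m: "inverse (2 ^ m) < e / real CARD('d)"
      using real_arch_pow_inv[of "e / real CARD('d)" "1/2"] e(1)
      by (auto simp: power_divide inverse_eq_divide)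
    have "y \<in> U" if y: "y \<in> supball x (exp (- real m))" for y
    proof (rule e(2))
      have *: "dist (y $ i) (x $ i) < e / real CARD('d)" for i
        using y m fabs_less_iff_dist[of "y $ i" "x $ i" m]
        by (auto simp: supball_def supnorm_less_iff)
      have "dist y x \<le> (\<Sum>i\<in>UNIV. dist (y $ i) (x $ i))"
        unfolding dist_vec_def by (rule L2_set_le_sum) auto
      also have "\<dots> < (\<Sum>i\<in>(UNIV :: 'd set). e / real CARD('d))"
        by (rule sum_strict_mono) (use * in auto)
      also have "\<dots> = e" by simp
      finally show "dist y x < e" .
    qed
    then show "\<exists>r>0. supball x r \<subseteq> U" by (intro exI[of _ "exp (- real m)"]) auto
  qed
next
  assume U: "\<forall>x\<in>U. \<exists>r>0. supball x r \<subseteq> U"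
  show "open U"
    unfolding open_dist
  proof
    fix x assume "x \<in> U"
    with U obtain r where r: "r > 0" "supball x r \<subseteq> U" by blast
    obtain m where "- ln r < real m" using reals_Archimedean2 by blast
    then have "- real m < ln r" by simp
    then have m: "exp (- real m) < r"
      by (metis exp_less_cancel_iff exp_ln r(1))
    have "y \<in> U" if y: "dist y x < inverse (2 ^ m)" for y
    proof -
      have "fabs ((y - x) $ i) < r" for i
        using y m fabs_less_iff_dist[of "y $ i" "x $ i" m] dist_vec_nth_le[of y i x]
        by auto
      then show ?thesis using r(2) by (auto simp: supball_def supnorm_less_iff)
    qed
    then show "\<exists>e>0. \<forall>y. dist y x < e \<longrightarrow> y \<in> U"
      by (intro exI[of _ "inverse (2 ^ m)"]) auto
  qed
qed

end

theory Submission
  imports Defs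
begin

text \<open>
  By transference, \<open>\<omega>(y, \<theta>) \<ge> 1\<close> for all \<open>\<theta>\<close> as soon as, for infinitely many \<open>m\<close> and \<open>t = m\<^sup>2\<close>, the lattice of the
  vectors \<open>(e\<^sup>-\<^sup>n\<^sup>t a, e\<^sup>t (b + a y))\<close> with \<open>(a, b) \<in> \<Lambda> \<times> \<Lambda>\<^sup>n\<close> has no nonzero vector shorter than \<open>e\<^sup>-\<^sup>m\<close>. For
  \<open>y = f(x)\<close> the set of the \<open>x\<close> in a ball at which there is such a vector is bounded by the quantitative
  nondivergence theorem of Kleinbock and Margulis: the covolumes of the rational subspaces are maxima
  of combinations of \<open>1, f\<^sub>1, \<dots>, f\<^sub>n\<close>, hence good functions, and nonplanarity bounds their suprema on the
  ball from below, uniformly in the subspace and in \<open>t\<close>. The bound tends to \<open>0\<close> as \<open>m\<close> grows.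
\<close>

text \<open>With t = m^2 and the threshold e^(-m), m is negligible against t while e^(-m) still
  tends to 0. Hence transference loses only a multiple of m against n t, so every \<omega> < 1 is
  reached, and the exceptional measure is at most a constant times e^(-\<alpha> m). A bad point is
  exceptional for all large m at once, so it suffices that this bound tends to 0; no series over m
  is summed. Good maps need not be continuous, so sublevel sets need not be open. Sets are therefore
  estimated in outer measure, and a density argument removes the points at which a function is small
  although it is large somewhere in every ball around them. Multivectors are given by coordinates
  because these are affine in y, and goodness and nonplanarity are conditions on affine
  combinations. Uniformity comes from integrality: a nonzero coordinate of an integral multivector
  has absolute value at least 1, and it can be moved to a coordinate whose weight does not decay
  with t.\<close>

unbundle fps_syntax

section \<open>The local field\<close>

lemma fabs_0 [simp]: "fabs 0 = 0"
  by (simp add: fabs_def)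

lemma fabs_ge_0 [simp]: "0 \<le> fabs a"
  by (simp add: fabs_def)

lemma fabs_pos_iff [simp]: "0 < fabs a \<longleftrightarrow> a \<noteq> 0"
  by (simp add: fabs_def)

lemma fabs_eq_0_iff [simp]: "fabs a = 0 \<longleftrightarrow> a = 0"
  by (simp add: fabs_def)

lemma fabs_1 [simp]: "fabs 1 = 1"
  by (simp add: fabs_def)

lemma fabs_mult: "fabs (a * b) = fabs a * fabs b"
  by (simp add: fabs_def exp_add[symmetric])

lemma fabs_minus [simp]: "fabs (- a) = fabs a"
  by (simp add: fabs_def)

lemma fabs_inverse: "fabs (inverse a) = inverse (fabs a)"
proof (cases "a = 0")
  case False
  then have "fabs a * fabs (inverse a) = 1"
    by (simp flip: fabs_mult)
  then show ?thesis
    by (metis inverse_unique)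
qed simp

text \<open>\<open>a $$ m\<close> is the coefficient of T^(-m). As the inequality is strict, the
  coefficient at index k vanishes too; the digit counts in the transference and the levels of balls
  rest on this convention.\<close>

lemma fabs_less_exp_iff: "fabs a < exp (- real_of_int k) \<longleftrightarrow> (\<forall>m\<le>k. a $$ m = 0)"
proof (cases "a = 0")
  case False
  then have "fabs a < exp (- real_of_int k) \<longleftrightarrow> k < fls_subdegree a"
    by (simp add: fabs_def)
  also have "\<dots> \<longleftrightarrow> (\<forall>m\<le>k. a $$ m = 0)"
    using False by (meson fls_eq0_below_subdegree fls_subdegree_greaterI le_less_trans
        linorder_not_less nth_fls_subdegree_nonzero)
  finally show ?thesis .
qed simp

text \<open>The ultrametric inequality: no constant is lost in the number of summands. Positivity of
  r covers the empty sum.\<close>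

lemma fabs_sum_less:
  fixes g :: "'i \<Rightarrow> 'k::{field,finite} fls"
  assumes "\<And>i. i \<in> A \<Longrightarrow> fabs (g i) < r" "0 < r"
  shows "fabs (sum g A) < r"
proof -
  have *: "fabs (a + b) < r" if "fabs a < r" "fabs b < r" for a b :: "'k fls"
  proof (cases "a = 0 \<or> b = 0 \<or> a + b = 0")
    case True
    then show ?thesis using that \<open>0 < r\<close> by auto
  next
    case False
    then have "min (fls_subdegree a) (fls_subdegree b) \<le> fls_subdegree (a + b)"
      by (intro fls_plus_subdegree) auto
    then have "fabs (a + b) \<le> max (fabs a) (fabs b)"
      using False by (auto simp: fabs_def min_def max_def split: if_splits)
    then show ?thesis using that by linarith
  qed
  show ?thesis
    using assms by (induction A rule: infinite_finite_induct) (auto intro: *)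
qed

lemma fabs_add_less: "fabs a < r \<Longrightarrow> fabs b < r \<Longrightarrow> fabs (a + b) < r"
  using fabs_sum_less[of UNIV "\<lambda>i. if i then a else b" r] fabs_ge_0[of a]
  by (simp add: UNIV_bool add.commute del: fabs_ge_0)

section \<open>The polynomial ring inside the field\<close>

lemma of_poly_0 [simp]: "of_poly 0 = 0"
  by (simp add: of_poly_def)

lemma of_poly_pCons: "of_poly (pCons a p) = fls_const a + fls_X_inv * of_poly p"
  by (simp add: of_poly_def map_poly_pCons)

lemma of_poly_1 [simp]: "of_poly 1 = 1"
  by (simp add: of_poly_def)

lemma of_poly_nth: "of_poly p $$ m = (if m \<le> 0 then coeff p (nat (- m)) else 0)"
proof (induction p arbitrary: m)
  case (pCons a p)
  have *: "(fls_X_inv * of_poly p) $$ m = of_poly p $$ (m + 1)"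
    by (simp add: fls_X_inv_times_conv_shift)
  show ?case
  proof (cases "m < 0")
    case True
    then have "nat (- m) = Suc (nat (- (m + 1)))" by linarith
    then show ?thesis using True
      by (simp add: of_poly_pCons * pCons.IH)
  qed (auto simp: of_poly_pCons * pCons.IH)
qed simp

lemma of_poly_eq_iff [simp]: "of_poly p = of_poly q \<longleftrightarrow> p = q"
proof
  assume "of_poly p = of_poly q"
  then have "of_poly p $$ (- int n) = of_poly q $$ (- int n)" for n by simp
  then show "p = q" by (simp add: of_poly_nth poly_eq_iff)
qed simp

lemma of_poly_eq_0_iff [simp]: "of_poly p = 0 \<longleftrightarrow> p = 0"
  using of_poly_eq_iff[of p 0] by (simp del: of_poly_eq_iff)

lemma of_poly_add: "of_poly (p + q) = of_poly p + of_poly q"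
  by (simp add: fls_eq_iff of_poly_nth)

lemma of_poly_minus: "of_poly (- p) = - of_poly p"
  by (simp add: fls_eq_iff of_poly_nth)

lemma of_poly_smult: "of_poly (smult a p) = fls_const a * of_poly p"
  by (simp add: fls_eq_iff of_poly_nth)

lemma of_poly_mult: "of_poly (p * q) = of_poly p * of_poly q"
  by (induction p) (auto simp: of_poly_pCons of_poly_add of_poly_smult mult_pCons_left algebra_simps)

definition intg :: "'k::{field,finite} fls set" where
  "intg = range of_poly"

lemma intg_0 [simp]: "0 \<in> intg"
  unfolding intg_def using of_poly_0 by (metis rangeI)

lemma intg_1 [simp]: "1 \<in> intg"
  unfolding intg_def using of_poly_1 by (metis rangeI)

lemma intg_add: "a \<in> intg \<Longrightarrow> b \<in> intg \<Longrightarrow> a + b \<in> intg"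
  unfolding intg_def by (auto simp flip: of_poly_add)

lemma intg_minus: "a \<in> intg \<Longrightarrow> - a \<in> intg"
  unfolding intg_def by (auto simp flip: of_poly_minus)

lemma intg_mult: "a \<in> intg \<Longrightarrow> b \<in> intg \<Longrightarrow> a * b \<in> intg"
  unfolding intg_def by (auto simp flip: of_poly_mult)

lemma intg_sum: "(\<And>i. i \<in> A \<Longrightarrow> g i \<in> intg) \<Longrightarrow> sum g A \<in> intg"
  by (induction A rule: infinite_finite_induct) (auto intro: intg_add)

lemma fabs_of_poly: "p \<noteq> 0 \<Longrightarrow> fabs (of_poly p) = exp (real (degree p))"
proof -
  assume "p \<noteq> 0"
  then have "fls_subdegree (of_poly p) = - int (degree p)"
    by (intro fls_subdegree_eqI) (auto simp: of_poly_nth coeff_eq_0)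
  then show ?thesis using \<open>p \<noteq> 0\<close> by (simp add: fabs_def)
qed

text \<open>Discreteness of \<Lambda> in F, the source of the lower bounds that are uniform over all
  rational subspaces.\<close>

lemma fabs_intg_ge_1: "a \<in> intg \<Longrightarrow> a \<noteq> 0 \<Longrightarrow> 1 \<le> fabs a"
  by (auto simp: intg_def fabs_of_poly)

lemma countable_intg: "countable (intg :: 'k::{field,finite} fls set)"
proof -
  have "\<exists>cs. p = Poly cs" for p :: "'k poly"
    by (metis Poly_coeffs)
  then have "(UNIV :: 'k poly set) = range Poly" by auto
  moreover have "countable (UNIV :: 'k list set)" by simp
  ultimately show ?thesis
    unfolding intg_def by (metis countable_image)
qed

lemma ex_of_poly_coeffs:
  fixes c :: "nat \<Rightarrow> 'k::{field,finite}"
  obtains p where "\<And>m. of_poly p $$ m = (if - int N < m \<and> m \<le> 0 then c (nat (- m)) else 0)"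
proof -
  obtain p where p: "\<And>n. coeff p n = (if n < N then c n else 0)"
  proof
    show "coeff (poly_of_list (map c [0..<N])) n = (if n < N then c n else 0)" for n
      by (auto simp: nth_default_def)
  qed
  show ?thesis
    by (rule that[of p]) (auto simp: of_poly_nth p)
qed

text \<open>Only finitely many digits at indices at most 0 are nonzero, so they form a polynomial.
  Subtracting it leaves the fractional part.\<close>

lemma ex_of_poly_polynomial_part:
  fixes a :: "'k::{field,finite} fls"
  obtains p where "\<And>m. m \<le> 0 \<Longrightarrow> of_poly p $$ m = a $$ m"
proof -
  obtain p where p: "\<And>m. of_poly p $$ m =
    (if - int (nat (1 - fls_subdegree a)) < m \<and> m \<le> 0 then a $$ (- int (nat (- m))) else 0)"
    using ex_of_poly_coeffs[where N = "nat (1 - fls_subdegree a)" and c = "\<lambda>n. a $$ (- int n)"] by metis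
  show ?thesis
    by (rule that[of p]) (auto simp: p)
qed

section \<open>Multivectors\<close>

definition fun_subspace :: "('i \<Rightarrow> 'a::comm_ring_1) set \<Rightarrow> bool" where
  "fun_subspace E \<longleftrightarrow> (\<lambda>_. 0) \<in> E \<and> (\<forall>a\<in>E. \<forall>b\<in>E. (\<lambda>i. a i + b i) \<in> E) \<and> (\<forall>c. \<forall>a\<in>E. (\<lambda>i. c * a i) \<in> E)"

text \<open>Gaussian elimination: a pivot \<open>e0\<close> with nonzero coordinate j clears that
  coordinate from all vectors, and the induction hypothesis applies to the elements of E vanishing
  at j. The index type is arbitrary, so that the same duality serves sequences of digits over the
  finite field and vectors over F.\<close>

lemma separating_coefficients:
  fixes E :: "('i \<Rightarrow> 'a::field) set"
  assumes "finite I" "fun_subspace E" "\<And>e. e \<in> E \<Longrightarrow> \<exists>i\<in>I. e i \<noteq> u i"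
  shows "\<exists>c. (\<forall>e\<in>E. (\<Sum>i\<in>I. c i * e i) = 0) \<and> (\<Sum>i\<in>I. c i * u i) \<noteq> 0"
  using assms
proof (induction arbitrary: E u rule: finite_psubset_induct)
  case (psubset I)
  note sub = psubset.prems(1)[unfolded fun_subspace_def]
  show ?case
  proof (cases "\<forall>e\<in>E. \<forall>i\<in>I. e i = 0")
    case True
    obtain i where i: "i \<in> I" "u i \<noteq> 0"
      using psubset.prems(2)[of "\<lambda>_. 0"] sub by auto
    have "(\<Sum>k\<in>I. (if k = i then 1 else 0) * e k) = e i" for e :: "'i \<Rightarrow> 'a"
      using i psubset.hyps by (simp add: if_distrib[of "\<lambda>x. x * _"] cong: if_cong)
    then show ?thesis using True i by (intro exI[of _ "\<lambda>k. if k = i then 1 else 0"]) auto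
  next
    case False
    then obtain e0 j where e0: "e0 \<in> E" "j \<in> I" "e0 j \<noteq> 0" by blast
    define elim where "elim e = (\<lambda>i. e i + (- (e j / e0 j)) * e0 i)" for e
    have elim: "elim e \<in> E" "elim e j = 0" if "e \<in> E" for e
    proof -
      have "(\<lambda>i. - (e j / e0 j) * e0 i) \<in> E" using e0(1) sub by blast
      moreover have "\<And>a b. a \<in> E \<Longrightarrow> b \<in> E \<Longrightarrow> (\<lambda>i. a i + b i) \<in> E" using sub by blast
      ultimately show "elim e \<in> E" unfolding elim_def using that by blast
      show "elim e j = 0" using e0(3) by (simp add: elim_def)
    qed
    have unmatched: "\<exists>i\<in>I - {j}. e i \<noteq> elim u i" if e: "e \<in> {e \<in> E. e j = 0}" for e
    proof (rule ccontr)
      assume "\<not> ?thesis"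
      then have *: "e i = elim u i" if "i \<in> I" for i
        using that e e0(3) by (cases "i = j") (auto simp: elim_def)
      have "(\<lambda>i. u j / e0 j * e0 i) \<in> E" using e0(1) sub by blast
      moreover have "\<And>a b. a \<in> E \<Longrightarrow> b \<in> E \<Longrightarrow> (\<lambda>i. a i + b i) \<in> E" using sub by blast
      ultimately have "(\<lambda>i. e i + u j / e0 j * e0 i) \<in> E" using e by blast
      then obtain i where "i \<in> I" "e i + u j / e0 j * e0 i \<noteq> u i"
        using psubset.prems(2) by meson
      then show False using * by (simp add: elim_def)
    qed
    have "fun_subspace {e \<in> E. e j = 0}"
      using sub by (auto simp: fun_subspace_def)
    then obtain c where c: "\<And>e. e \<in> E \<Longrightarrow> e j = 0 \<Longrightarrow> (\<Sum>i\<in>I - {j}. c i * e i) = 0"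
      "(\<Sum>i\<in>I - {j}. c i * elim u i) \<noteq> 0"
      using psubset.IH[of "I - {j}" "{e \<in> E. e j = 0}" "elim u"] e0(2) unmatched by blast
    \<comment> \<open>The coefficient at j is chosen so that the functional vanishes on
      \<open>e0\<close>; its value on e is then the value of c on \<open>elim e\<close>.\<close>
    define d where "d = c(j := - (\<Sum>i\<in>I - {j}. c i * e0 i) / e0 j)"
    have d: "(\<Sum>i\<in>I. d i * e i) = (\<Sum>i\<in>I - {j}. c i * elim e i)" for e
    proof -
      have "(\<Sum>i\<in>I. d i * e i) = d j * e j + (\<Sum>i\<in>I - {j}. c i * e i)"
        using psubset.hyps e0(2) by (subst sum.remove[of _ j]) (auto simp: d_def)
      moreover have "(\<Sum>i\<in>I - {j}. c i * elim e i) =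
          (\<Sum>i\<in>I - {j}. c i * e i) - (e j / e0 j) * (\<Sum>i\<in>I - {j}. c i * e0 i)"
        unfolding elim_def sum_distrib_left sum_subtractf[symmetric]
        by (intro sum.cong) (auto simp: algebra_simps)
      ultimately show ?thesis by (simp add: d_def)
    qed
    show ?thesis
      using c elim d by (intro exI[of _ d]) auto
  qed
qed

text \<open>
  A multivector is the family of its coordinates, indexed by the subsets of the index type; the signs
  refer to the linear order that \<^const>\<open>to_nat\<close> induces on it.
\<close>

type_synonym ('i, 'a) mvec = "'i set \<Rightarrow> 'a"

section \<open>Exterior and interior multiplication\<close>

definition sg :: "'i::finite \<Rightarrow> 'i set \<Rightarrow> 'a::comm_ring_1" where
  "sg i S = (-1) ^ card {k \<in> S. to_nat k < to_nat i}"

definition wdg :: "('i::finite \<Rightarrow> 'a::comm_ring_1) \<Rightarrow> ('i, 'a) mvec \<Rightarrow> ('i, 'a) mvec" where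
  "wdg v w S = (\<Sum>i\<in>S. sg i S * v i * w (S - {i}))"

text \<open>Interior multiplication by the functional c, as \<open>wdg\<close> is exterior
  multiplication by the vector v. The sign \<open>sg i S\<close> does not depend on whether i lies
  in S, so one sign serves for removing an index and for inserting one.\<close>

definition contr :: "('i::finite \<Rightarrow> 'a::comm_ring_1) \<Rightarrow> ('i, 'a) mvec \<Rightarrow> ('i, 'a) mvec" where
  "contr c w S = (\<Sum>i\<in>- S. sg i S * c i * w (insert i S))"

definition pair :: "('i::finite \<Rightarrow> 'a::comm_ring_1) \<Rightarrow> ('i \<Rightarrow> 'a) \<Rightarrow> 'a" where
  "pair c v = (\<Sum>i\<in>UNIV. c i * v i)"

lemma sg_mult_self [simp]: "sg i S * sg i S = (1 :: 'a::comm_ring_1)"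
  by (simp add: sg_def flip: power_mult_distrib)

lemma sg_insert:
  assumes "i \<noteq> j" "j \<notin> S"
  shows "sg i (insert j S) = (if to_nat j < to_nat i then - sg i S else (sg i S :: 'a::comm_ring_1))"
proof -
  have "{k \<in> insert j S. to_nat k < to_nat i} =
      (if to_nat j < to_nat i then insert j {k \<in> S. to_nat k < to_nat i} else {k \<in> S. to_nat k < to_nat i})"
    by auto
  then show ?thesis using assms by (simp add: sg_def)
qed

text \<open>Exactly one of i and j precedes the other, so exactly one of the two insertions changes
  a sign. The first form is for two exterior products, the second for an exterior product and a
  contraction.\<close>

lemma sg_insert_swap:
  fixes S :: "'i::finite set"
  assumes "i \<noteq> j" "i \<notin> S" "j \<notin> S"
  shows "sg i (insert j S) * sg j S = - (sg j (insert i S) * sg i S :: 'a::comm_ring_1)"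
    and "sg j (insert i S) * sg i (insert j S) = - (sg i S * sg j S :: 'a::comm_ring_1)"
proof -
  have "to_nat i \<noteq> to_nat j" using assms by (simp add: inj_eq)
  then have "to_nat i < to_nat j \<and> \<not> to_nat j < to_nat i \<or> \<not> to_nat i < to_nat j \<and> to_nat j < to_nat i"
    by linarith
  then show "sg i (insert j S) * sg j S = - (sg j (insert i S) * sg i S :: 'a::comm_ring_1)"
    and "sg j (insert i S) * sg i (insert j S) = - (sg i S * sg j S :: 'a::comm_ring_1)"
    using assms by (auto simp: sg_insert algebra_simps)
qed

lemma sg_self [simp]: "sg i (insert i S) = sg i S" "sg i (S - {i}) = sg i S"
proof -
  have "{k \<in> insert i S. to_nat k < to_nat i} = {k \<in> S. to_nat k < to_nat i}"
    "{k \<in> S - {i}. to_nat k < to_nat i} = {k \<in> S. to_nat k < to_nat i}"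
    by auto
  then show "sg i (insert i S) = sg i S" "sg i (S - {i}) = sg i S"
    unfolding sg_def by simp_all
qed

lemma sign_swap:
  shows "P = - Q \<Longrightarrow> - (Q * b * a * z) = P * a * b * (z :: 'a::comm_ring_1)"
  and "P = - Q \<Longrightarrow> Q * b * a * z = - (P * a * b * (z :: 'a::comm_ring_1))"
  by (simp_all add: ac_simps)

lemma wdg_wdg_swap: 
  fixes u v :: "'i::finite \<Rightarrow> 'a::comm_ring_1"
  shows "wdg u (wdg v w) S = - wdg v (wdg u w) S"
proof -
  have expand: "wdg u (wdg v w) S = 
      (\<Sum>(i,j)\<in>{(i,j). i \<in> S \<and> j \<in> S \<and> i \<noteq> j}. sg i S * sg j (S - {i}) * u i * v j * w (S - {i,j}))"
    for u v :: "'i \<Rightarrow> 'a"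
  proof -
    have "wdg u (wdg v w) S = (\<Sum>i\<in>S. \<Sum>j\<in>S - {i}. sg i S * sg j (S - {i}) * u i * v j * w (S - {i,j}))"
      unfolding wdg_def sum_distrib_left Diff_insert2[of S _ "{_}"]
      by (intro sum.cong refl) (simp only: ac_simps)
    also have "\<dots> = (\<Sum>(i,j)\<in>Sigma S (\<lambda>i. S - {i}). sg i S * sg j (S - {i}) * u i * v j * w (S - {i,j}))"
      by (rule sum.Sigma) auto
    also have "Sigma S (\<lambda>i. S - {i}) = {(i,j). i \<in> S \<and> j \<in> S \<and> i \<noteq> j}" by auto
    finally show ?thesis .
  qed
  have "wdg u (wdg v w) S = 
     (\<Sum>(i,j)\<in>{(i,j). i \<in> S \<and> j \<in> S \<and> i \<noteq> j}. - (sg i S * sg j (S - {i}) * v i * u j * w (S - {i,j})))"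
    unfolding expand
  proof (rule sum.reindex_bij_witness[of _ "\<lambda>(i,j). (j,i)" "\<lambda>(i,j). (j,i)"])
    fix p assume "p \<in> {(i,j). i \<in> S \<and> j \<in> S \<and> i \<noteq> j}"
    then obtain i j where p: "p = (i,j)" "i \<in> S" "j \<in> S" "i \<noteq> j" by blast
    define A where "A = S - {i,j}"
    have A: "S - {i} = insert j A" "S - {j} = insert i A" "S = insert i (insert j A)" "i \<notin> A" "j \<notin> A"
      using p by (auto simp: A_def)
    have "S = insert i (insert j A)" "S = insert j (insert i A)" using A(3) by blast+
    then have 1: "(sg i S :: 'a) = sg i (insert j A)" "(sg j S :: 'a) = sg j (insert i A)"
      by (metis sg_self(1))+
    have "(sg i S * sg j (S - {i}) :: 'a) = - (sg j S * sg i (S - {j}))"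
      unfolding 1 A(1,2) sg_self(1) by (rule sg_insert_swap(1)) (use p(4) A(4,5) in auto)
    then show "(case case p of (i, j) \<Rightarrow> (j, i) of
           (i, j) \<Rightarrow> - (sg i S * sg j (S - {i}) * v i * u j * w (S - {i, j}))) =
          (case p of (i, j) \<Rightarrow> sg i S * sg j (S - {i}) * u i * v j * w (S - {i, j}))"
      unfolding p(1) prod.case insert_commute[of j i "{}"] by (rule sign_swap(1))
  qed auto
  also have "\<dots> = - wdg v (wdg u w) S"
    unfolding expand by (simp add: sum_negf case_prod_unfold)
  finally show ?thesis .
qed

text \<open>In characteristic 2 this does not follow from \<open>wdg_wdg_swap\<close>, which then
  only says that the value equals itself. The terms for (i, j) and (j, i) are therefore cancelled
  against each other directly.\<close>

lemma wdg_self_wdg: 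
  fixes u :: "'i::finite \<Rightarrow> 'a::comm_ring_1"
  shows "wdg u (wdg u w) S = 0"
proof -
  let ?P = "{(i,j). i \<in> S \<and> j \<in> S \<and> i \<noteq> j}"
  let ?Q = "{(i,j). i \<in> S \<and> j \<in> S \<and> to_nat i < to_nat j}"
  let ?h = "\<lambda>(i,j). sg i S * sg j (S - {i}) * u i * u j * w (S - {i,j})"
  have "wdg u (wdg u w) S = (\<Sum>i\<in>S. \<Sum>j\<in>S - {i}. sg i S * sg j (S - {i}) * u i * u j * w (S - {i,j}))"
    unfolding wdg_def sum_distrib_left Diff_insert2[of S _ "{_}"]
    by (intro sum.cong refl) (simp only: ac_simps)
  also have "\<dots> = sum ?h (Sigma S (\<lambda>i. S - {i}))"
    by (rule sum.Sigma) auto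
  also have "Sigma S (\<lambda>i. S - {i}) = ?Q \<union> (\<lambda>(i,j). (j,i)) ` ?Q"
    by (auto simp: image_iff neq_iff) (metis from_nat_to_nat linorder_neqE_nat)+
  also have "sum ?h \<dots> = sum ?h ?Q + sum ?h ((\<lambda>(i,j). (j,i)) ` ?Q)"
    by (rule sum.union_disjoint) auto
  also have "sum ?h ((\<lambda>(i,j). (j,i)) ` ?Q) = sum (\<lambda>p. - ?h p) ?Q"
  proof (subst sum.reindex)
    show "inj_on (\<lambda>(i,j). (j,i)) ?Q" by (auto simp: inj_on_def)
    show "sum (?h \<circ> (\<lambda>(i,j). (j,i))) ?Q = sum (\<lambda>p. - ?h p) ?Q"
    proof (rule sum.cong)
      fix p assume "p \<in> ?Q"
      then obtain i j where p: "p = (i,j)" "i \<in> S" "j \<in> S" "i \<noteq> j" by auto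
      define A where "A = S - {i,j}"
      have A: "S - {i} = insert j A" "S - {j} = insert i A" "S = insert i (insert j A)" "i \<notin> A" "j \<notin> A"
        using p by (auto simp: A_def)
      have "S = insert i (insert j A)" "S = insert j (insert i A)" using A(3) by blast+
      then have 1: "(sg i S :: 'a) = sg i (insert j A)" "(sg j S :: 'a) = sg j (insert i A)"
        by (metis sg_self(1))+
      have "(sg i S * sg j (S - {i}) :: 'a) = - (sg j S * sg i (S - {j}))"
        unfolding 1 A(1,2) sg_self(1) by (rule sg_insert_swap(1)) (use p(4) A(4,5) in auto)
      then show "(?h \<circ> (\<lambda>(i,j). (j,i))) p = - ?h p"
        unfolding o_def p(1) prod.case insert_commute[of j i "{}"] by (rule sign_swap(2))
    qed simp
  qed
  finally show ?thesis by (simp add: sum_negf)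
qed

text \<open>Contraction is an antiderivation. The terms in which the index inserted equals the index
  removed run over the complement of S on the left and over S on the right, and together give
  \<open>pair c v\<close>; the remaining terms cancel by the sign rule.\<close>

lemma contr_wdg:
  fixes v :: "'i::finite \<Rightarrow> 'a::comm_ring_1"
  shows "contr c (wdg v w) S = pair c v * w S - wdg v (contr c w) S"
proof -
  have alg: "X = P * z - Y" if "P = a + b" "X = b * z + h" "Y = a * z + - h" for P X Y a b h z :: 'a
    using that by (simp add: algebra_simps)
  define h where "h k i = sg k S * c k * (sg i (insert k S) * v i * w (insert k S - {i}))" for k i
  have "contr c (wdg v w) S = (\<Sum>k\<in>-S. \<Sum>i\<in>insert k S. h k i)"
    unfolding contr_def wdg_def h_def sum_distrib_left ..
  also have "\<dots> = (\<Sum>k\<in>-S. h k k + (\<Sum>i\<in>S. h k i))"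
    by (intro sum.cong) auto
  also have "\<dots> = (\<Sum>k\<in>-S. h k k) + (\<Sum>i\<in>S. \<Sum>k\<in>-S. h k i)"
    by (simp add: sum.distrib sum.swap[of _ S])
  also have "(\<Sum>k\<in>-S. h k k) = (\<Sum>k\<in>-S. c k * v k) * w S"
    unfolding sum_distrib_right h_def by (intro sum.cong) (auto simp: algebra_simps)
  finally have 1: "contr c (wdg v w) S = (\<Sum>k\<in>-S. c k * v k) * w S + (\<Sum>i\<in>S. \<Sum>k\<in>-S. h k i)" .
  define g where "g i k = sg i S * v i * (sg k (S - {i}) * c k * w (insert k (S - {i})))" for i k
  have "wdg v (contr c w) S = (\<Sum>i\<in>S. \<Sum>k\<in>-(S - {i}). g i k)"
    unfolding contr_def wdg_def g_def sum_distrib_left ..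
  also have "\<dots> = (\<Sum>i\<in>S. g i i + (\<Sum>k\<in>-S. g i k))"
  proof (rule sum.cong)
    fix i assume "i \<in> S"
    then have "- (S - {i}) = insert i (- S)" by auto
    then show "(\<Sum>k\<in>-(S - {i}). g i k) = g i i + (\<Sum>k\<in>-S. g i k)" using \<open>i \<in> S\<close> by simp
  qed simp
  also have "\<dots> = (\<Sum>i\<in>S. g i i) + (\<Sum>i\<in>S. \<Sum>k\<in>-S. g i k)"
    by (simp add: sum.distrib)
  also have "(\<Sum>i\<in>S. g i i) = (\<Sum>i\<in>S. c i * v i) * w S"
    unfolding sum_distrib_right g_def
    by (intro sum.cong) (auto simp: algebra_simps insert_absorb)
  also have "(\<Sum>i\<in>S. \<Sum>k\<in>-S. g i k) = - (\<Sum>i\<in>S. \<Sum>k\<in>-S. h k i)"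
    unfolding sum_negf[symmetric]
  proof (intro sum.cong refl)
    fix i k assume ik: "i \<in> S" "k \<in> - S"
    define A where "A = S - {i}"
    have A: "S = insert i A" "i \<notin> A" "k \<notin> A" "i \<noteq> k" "insert k S - {i} = insert k A"
      using ik by (auto simp: A_def)
    have "insert k S = insert i (insert k A)" using A(1) by blast
    then have e1: "(sg i (insert k S) :: 'a) = sg i (insert k A)" by (simp only: sg_self)
    have e2: "(sg i S :: 'a) = sg i A" "(sg k S :: 'a) = sg k (insert i A)" "S - {i} = A"
      by (simp only: sg_self A_def) (simp only: A(1)[symmetric], simp only: A_def)
    have "(sg k S * sg i (insert k S) :: 'a) = - (sg i S * sg k (S - {i}))"
      unfolding e1 e2 by (rule sg_insert_swap(2)) (use A in auto)
    moreover have "h k i = (sg k S * sg i (insert k S)) * (c k * v i * w (insert k A))"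
      unfolding h_def A(5) by (simp only: ac_simps)
    ultimately have "h k i = - (sg i S * sg k (S - {i})) * (c k * v i * w (insert k A))"
      by (simp only:)
    then show "g i k = - h k i"
      unfolding g_def A_def by (simp add: mult.assoc mult.left_commute)
  qed
  finally have 2: "wdg v (contr c w) S = (\<Sum>i\<in>S. c i * v i) * w S + - (\<Sum>i\<in>S. \<Sum>k\<in>-S. h k i)" .
  have "pair c v = (\<Sum>i\<in>S. c i * v i) + (\<Sum>k\<in>-S. c k * v k)"
    unfolding pair_def using sum.union_disjoint[of S "- S" "\<lambda>i. c i * v i"] by simp
  then show ?thesis
    using alg[OF _ 1 2, of "pair c v"] by blast
qed

lemma wdg_linear:
  fixes u v :: "'i::finite \<Rightarrow> 'a::comm_ring_1"
  shows "wdg (\<lambda>i. u i + v i) w S = wdg u w S + wdg v w S"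
    and "wdg (\<lambda>i. c * v i) w S = c * wdg v w S"
    and "wdg v (\<lambda>S. w S + w' S) S = wdg v w S + wdg v w' S"
    and "wdg v (\<lambda>S. w S - w' S) S = wdg v w S - wdg v w' S"
    and "wdg v (\<lambda>S. c * w S) S = c * wdg v w S"
    and "wdg (\<lambda>_. 0) w S = 0"
    and "wdg v (\<lambda>_. 0) S = 0"
  by (simp_all add: wdg_def sum.distrib sum_subtractf sum_distrib_left algebra_simps)

lemma contr_scale: "contr c (\<lambda>S. a * w S) S = a * contr c w S"
  by (simp add: contr_def sum_distrib_left mult.left_commute)

lemma contr_0 [simp]: "contr c (\<lambda>_. 0) S = 0"
  by (simp add: contr_def)

text \<open>The action on multivectors of the map sending v to v + \<open>pair c v\<close> y. As y
  occurs at most once in a nonzero product, one correction term is enough, and the result is affine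
  in y.\<close>

definition transv :: "('i::finite \<Rightarrow> 'a::comm_ring_1) \<Rightarrow> ('i \<Rightarrow> 'a) \<Rightarrow> ('i, 'a) mvec \<Rightarrow> ('i, 'a) mvec" where
  "transv c y w S = w S + wdg y (contr c w) S"

lemma transv_wdg:
  "transv c y (wdg v w) S = wdg (\<lambda>i. v i + pair c v * y i) (transv c y w) S"
proof -
  have 1: "contr c (wdg v w) = (\<lambda>S. pair c v * w S - wdg v (contr c w) S)"
    by (simp add: fun_eq_iff contr_wdg)
  have 2: "transv c y w = (\<lambda>S. w S + wdg y (contr c w) S)"
    by (simp add: fun_eq_iff transv_def)
  show ?thesis
    unfolding transv_def[of c y "wdg v w"] 1 2 wdg_linear
    using wdg_wdg_swap[of y v "contr c w" S] wdg_self_wdg[of y "contr c w" S]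
    by (simp add: algebra_simps)
qed

lemma transv_scale: "transv c y (\<lambda>S. a * w S) S = a * transv c y w S"
proof -
  have "contr c (\<lambda>S. a * w S) = (\<lambda>S. a * contr c w S)"
    by (simp add: fun_eq_iff contr_scale)
  then show ?thesis by (simp add: transv_def wdg_linear algebra_simps)
qed

text \<open>Decomposable multivectors of degree \<open>j\<close>; zero is not excluded.\<close>

inductive dec :: "nat \<Rightarrow> ('i::finite, 'a::comm_ring_1) mvec \<Rightarrow> bool" where
  dec_0: "dec 0 (\<lambda>S. if S = {} then c else 0)"
| dec_Suc: "dec j w \<Longrightarrow> dec (Suc j) (wdg v w)"

lemma dec_scale: "dec j w \<Longrightarrow> dec j (\<lambda>S. c * w S)"
proof (induction rule: dec.cases)
  case (dec_0 a)
  have "(\<lambda>S. c * (if S = {} then a else 0)) = (\<lambda>S :: 'a set. if S = {} then c * a else 0)"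
    by (simp add: fun_eq_iff)
  then show ?case using dec_0 dec.dec_0 by metis
next
  case (dec_Suc j w v)
  have "(\<lambda>S. c * wdg v w S) = wdg (\<lambda>i. c * v i) w"
    by (simp add: fun_eq_iff wdg_linear)
  then show ?case using dec_Suc dec.dec_Suc by metis
qed

lemma dec_card: "dec j w \<Longrightarrow> w S \<noteq> 0 \<Longrightarrow> card S = j"
proof (induction arbitrary: S rule: dec.induct)
  case (dec_Suc j w v)
  then obtain i where "i \<in> S" "w (S - {i}) \<noteq> 0"
    unfolding wdg_def by (metis (no_types, lifting) mult_zero_right sum.neutral)
  then show ?case
    using dec_Suc.IH[of "S - {i}"] by (metis card.remove finite)
qed (simp split: if_splits)

lemma dec_le_card: "dec j w \<Longrightarrow> w \<noteq> (\<lambda>_. 0) \<Longrightarrow> j \<le> CARD('i)" for w :: "('i::finite, 'a::comm_ring_1) mvec"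
  using dec_card[of j w] by (metis card_mono finite subset_UNIV)

text \<open>For a nonzero decomposable multivector this is the span of its factors, so inclusion of
  subspaces can be expressed without choosing bases.\<close>

definition ann :: "('i::finite, 'a::comm_ring_1) mvec \<Rightarrow> ('i \<Rightarrow> 'a) set" where
  "ann w = {v. \<forall>S. wdg v w S = 0}"

lemma fun_subspace_ann: "fun_subspace (ann w)"
  by (simp add: fun_subspace_def ann_def wdg_linear)

lemma ann_scale: "c \<noteq> 0 \<Longrightarrow> ann (\<lambda>S. c * w S) = ann w" for c :: "'a::field"
  by (simp add: ann_def wdg_linear)

lemma in_ann_wdg: "v \<in> ann (wdg v w)"
  by (simp add: ann_def wdg_self_wdg)

lemma ann_subset_ann_wdg: "ann w \<subseteq> ann (wdg v w)"
proof
  fix u assume "u \<in> ann w"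
  then have "wdg u w = (\<lambda>_. 0)" by (simp add: ann_def fun_eq_iff)
  then show "u \<in> ann (wdg v w)"
    by (simp add: ann_def wdg_wdg_swap[of u v] wdg_linear)
qed

text \<open>By the antiderivation rule contraction removes one factor at a time, and every factor is
  annihilated by the product.\<close>

lemma contr_eq_0:
  assumes "dec j w" "\<And>v. v \<in> ann w \<Longrightarrow> pair c v = 0"
  shows "contr c w S = 0"
  using assms
proof (induction arbitrary: S rule: dec.induct)
  case (dec_0 a)
  then show ?case by (simp add: contr_def)
next
  case (dec_Suc j w v)
  have "contr c w S = 0" for S
    using dec_Suc.IH dec_Suc.prems ann_subset_ann_wdg by blast
  then have "contr c w = (\<lambda>_. 0)" by blast
  then show ?case
    using dec_Suc.prems[OF in_ann_wdg] unfolding contr_wdg by (simp add: wdg_linear)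
qed

lemma separating_functional:
  fixes W :: "('i::finite \<Rightarrow> 'a::field) set"
  assumes "fun_subspace W" "u \<notin> W"
  obtains c where "\<And>v. v \<in> W \<Longrightarrow> pair c v = 0" "pair c u = 1"
proof -
  have "\<exists>i\<in>UNIV. e i \<noteq> u i" if "e \<in> W" for e
  proof (rule ccontr)
    assume "\<not> ?thesis"
    then have "e = u" by (simp add: fun_eq_iff)
    then show False using that assms(2) by simp
  qed
  then have "\<exists>c. (\<forall>e\<in>W. pair c e = 0) \<and> pair c u \<noteq> 0"
    unfolding pair_def by (intro separating_coefficients assms(1) finite)
  then obtain c where c: "\<And>v. v \<in> W \<Longrightarrow> pair c v = 0" "pair c u \<noteq> 0"
    by blast
  have "pair (\<lambda>i. c i / pair c u) v = pair c v / pair c u" for v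
    by (simp add: pair_def sum_divide_distrib)
  then show ?thesis
    using that[of "\<lambda>i. c i / pair c u"] c by simp
qed

text \<open>The span of w and v is the smallest subspace containing both. If u were annihilated by
  the product but outside W, contracting u \<and> (v \<and> w) = 0 with a functional that is 0 on W
  and 1 at u would give v \<and> w = 0.\<close>

lemma ann_wdg_subset:
  fixes w :: "('i::finite, 'a::field) mvec"
  assumes "dec j w" "v \<notin> ann w" "fun_subspace W" "ann w \<subseteq> W" "v \<in> W"
  shows "ann (wdg v w) \<subseteq> W"
proof (rule subsetI, rule ccontr)
  fix u assume u: "u \<in> ann (wdg v w)" "u \<notin> W"
  obtain c where c: "\<And>v. v \<in> W \<Longrightarrow> pair c v = 0" "pair c u = 1"
    using separating_functional[OF assms(3) u(2)] by blast
  have "contr c w S = 0" for S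
    using contr_eq_0[OF assms(1)] c(1) assms(4) by blast
  then have 1: "contr c w = (\<lambda>_. 0)" by blast
  then have 2: "contr c (wdg v w) = (\<lambda>_. 0)"
    using c(1)[OF assms(5)] by (intro ext) (simp add: contr_wdg wdg_linear)
  have 3: "wdg u (wdg v w) = (\<lambda>_. 0)" using u(1) by (simp add: ann_def fun_eq_iff)
  have "wdg v w S = 0" for S
    using contr_wdg[of c u "wdg v w" S] c(2) unfolding 2 3 by (simp add: wdg_linear)
  then show False using assms(2) by (simp add: ann_def)
qed

text \<open>A subspace determines its multivector up to a scalar. With c dual to the last factor v
  and zero on the others, w' equals v times its contraction by c, and this contraction satisfies the
  hypotheses one degree lower. A priori w' is only homogeneous.\<close>

lemma proportional_if_ann_subset:
  fixes w w' :: "('i::finite, 'a::field) mvec"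
  assumes "dec j w" "w \<noteq> (\<lambda>_. 0)" "\<And>S. w' S \<noteq> 0 \<Longrightarrow> card S = j" "ann w \<subseteq> ann w'"
  shows "\<exists>c. w' = (\<lambda>S. c * w S)"
  using assms
proof (induction arbitrary: w' rule: dec.induct)
  case (dec_0 a)
  then have "a \<noteq> 0" by (auto simp: fun_eq_iff)
  then have "w' = (\<lambda>S. (w' {} / a) * (if S = {} then a else 0))"
    using dec_0(2) by (auto simp: fun_eq_iff)
  then show ?case by blast
next
  case (dec_Suc j w v)
  have v: "v \<notin> ann w" using dec_Suc.prems(1) by (auto simp: ann_def)
  then have w: "w \<noteq> (\<lambda>_. 0)" by (auto simp: ann_def wdg_linear)
  obtain c where c: "\<And>v. v \<in> ann w \<Longrightarrow> pair c v = 0" "pair c v = 1"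
    using separating_functional[OF fun_subspace_ann v] by blast
  have "v \<in> ann w'" using dec_Suc.prems(3) in_ann_wdg by blast
  then have "wdg v w' = (\<lambda>_. 0)" by (simp add: ann_def fun_eq_iff)
  then have w': "w' = wdg v (contr c w')"
    using contr_wdg[of c v w'] c(2) by (intro ext) (metis contr_0 eq_iff_diff_eq_0 mult_1)
  have "card S = j" if S: "contr c w' S \<noteq> 0" for S
  proof -
    obtain i where "i \<in> - S" "w' (insert i S) \<noteq> 0"
      using S unfolding contr_def by (metis (no_types, lifting) mult_zero_right sum.neutral)
    then show ?thesis using dec_Suc.prems(2)[of "insert i S"] by simp
  qed
  moreover have "ann w \<subseteq> ann (contr c w')"
  proof
    fix u assume u: "u \<in> ann w"
    then have "u \<in> ann w'" using dec_Suc.prems(3) ann_subset_ann_wdg by blast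
    then have "wdg u w' = (\<lambda>_. 0)" by (simp add: ann_def fun_eq_iff)
    then show "u \<in> ann (contr c w')"
      using contr_wdg[of c u w'] c(1)[OF u] by (simp add: ann_def)
  qed
  ultimately obtain a where a: "contr c w' = (\<lambda>S. a * w S)"
    using dec_Suc.IH[OF w] by blast
  have "w' = (\<lambda>S. a * wdg v w S)"
    by (subst w', intro ext) (simp add: a wdg_linear)
  then show ?case by blast
qed

section \<open>Transference\<close>

lemma of_poly_monom_mult: "of_poly (monom c n) * f = fls_const c * fls_shift (int n) f"
proof -
  have "of_poly (monom c n) = fls_const c * fls_X_inv ^ n"
  proof (induction n)
    case 0
    then show ?case by (simp add: monom_0 of_poly_pCons)
  next
    case (Suc n)
    then show ?case by (simp add: monom_Suc of_poly_pCons algebra_simps)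
  qed
  then show ?thesis
    by (simp only: mult.assoc fls_X_inv_power_times_conv_shift(1))
qed

lemma of_poly_sum: "of_poly (sum g A) = (\<Sum>i\<in>A. of_poly (g i))"
  by (induction A rule: infinite_finite_induct) (auto simp: of_poly_add)

lemma fls_sum_nth: "sum g A $$ m = (\<Sum>i\<in>A. g i $$ m)"
  by (induction A rule: infinite_finite_induct) auto

lemma dotp_nth: "dotp y z $$ m = (\<Sum>i\<in>UNIV. (vec_nth y i * vec_nth z i) $$ m)"
  by (simp add: dotp_def fls_sum_nth)

text \<open>
  Transference: the first \<open>M\<close> digits after the point of \<open>y \<cdot> q\<close> depend linearly over \<open>\<bbbF>\<^sub>q\<close> on \<open>q\<close>; a
  linear relation between these digits amounts to a pair \<open>(a, b)\<close> as in the hypothesis.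
\<close>

lemma exists_inhomogeneous_solution:
  fixes y :: "('k::{field,finite} fls) ^ 'n" and \<theta> :: "'k fls" and M N :: nat
  assumes no: "\<And>(a :: 'k poly) (b :: 'n \<Rightarrow> 'k poly). a \<noteq> 0 \<Longrightarrow> fabs (of_poly a) < exp (real M) \<Longrightarrow>
      (\<And>i. fabs (of_poly a * vec_nth y i + of_poly (b i)) < exp (- real N)) \<Longrightarrow> False"
    and M: "1 \<le> M"
  obtains p q where "q \<noteq> 0" "supnorm (of_poly_vec q) < exp (real N)"
    "fabs (dotp y (of_poly_vec q) - of_poly p - \<theta>) < exp (- (real M - 1))"
proof -
  define Q where "Q = {q :: 'k poly ^ 'n. supnorm (of_poly_vec q) < exp (real N)}"
  define e where "e q l = dotp y (of_poly_vec q) $$ int l" for q :: "'k poly ^ 'n" and l :: nat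
  \<comment> \<open>The digits 1 to M - 1 are prescribed by \<theta>. Digit M is sacrificed:
    prescribing 1 there excludes q = 0, at the price of M - 1 in place of M in the
    conclusion.\<close>
  define u where "u l = (if l = M then 1 else \<theta> $$ int l)" for l
  have Q_iff: "q \<in> Q \<longleftrightarrow> (\<forall>i. fabs (of_poly (vec_nth q i)) < exp (real N))" for q
    by (simp add: Q_def supnorm_less_iff of_poly_vec_def)
  have Q0: "0 \<in> Q" by (simp add: Q_iff)
  have Q_add: "q + q' \<in> Q" if "q \<in> Q" "q' \<in> Q" for q q'
    using that by (simp add: Q_iff of_poly_add fabs_add_less)
  have Q_smult: "(\<chi> i. smult c (vec_nth q i)) \<in> Q" if "q \<in> Q" for c q
  proof -
    have "fabs (fls_const c) \<le> 1" by (simp add: fabs_def)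
    then have "fabs (of_poly (smult c (vec_nth q i))) \<le> 1 * fabs (of_poly (vec_nth q i))" for i
      unfolding of_poly_smult fabs_mult by (intro mult_right_mono) auto
    then show ?thesis using that by (auto simp: Q_iff intro: le_less_trans)
  qed
  have e0: "e 0 = (\<lambda>_. 0)" by (simp add: e_def fun_eq_iff dotp_nth of_poly_vec_def)
  have e_add: "e (q + q') = (\<lambda>l. e q l + e q' l)" for q q'
    by (simp add: e_def fun_eq_iff dotp_nth of_poly_vec_def of_poly_add algebra_simps sum.distrib)
  have e_smult: "e (\<chi> i. smult c (vec_nth q i)) = (\<lambda>l. c * e q l)" for c q
    by (simp add: e_def fun_eq_iff dotp_nth of_poly_vec_def of_poly_smult sum_distrib_left mult.left_commute[of _ "fls_const c"])
  have sub: "fun_subspace (e ` Q)"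
    unfolding fun_subspace_def
    using Q0 Q_add Q_smult e0 e_add e_smult by (auto simp: image_iff) metis+
  have "\<exists>q\<in>Q. \<forall>l\<in>{1..M}. e q l = u l"
  proof (rule ccontr)
    assume "\<not> ?thesis"
    then have "\<And>v. v \<in> e ` Q \<Longrightarrow> \<exists>l\<in>{1..M}. v l \<noteq> u l" by auto
    from separating_coefficients[OF _ sub this]
    obtain c where c: "\<And>q. q \<in> Q \<Longrightarrow> (\<Sum>l\<in>{1..M}. c l * e q l) = 0" "(\<Sum>l\<in>{1..M}. c l * u l) \<noteq> 0"
      by auto
    \<comment> \<open>The coefficient of T^(l - 1) is \<open>c l\<close>, so that digit m + 1 of the
      product with \<open>y $ i\<close> is the linear relation evaluated at q = T^m in coordinate
      i.\<close>
    define a where "a = (\<Sum>l\<in>{1..M}. monom (c l) (l - 1))"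
    obtain l0 where l0: "l0 \<in> {1..M}" "c l0 \<noteq> 0"
      using c(2) by (metis (no_types, lifting) mult_zero_left sum.neutral)
    have coeff_a: "coeff a n = (if n < M then c (Suc n) else 0)" for n
    proof -
      have "coeff a n = (\<Sum>l\<in>{1..M}. if l = Suc n then c l else 0)"
        unfolding a_def coeff_sum by (intro sum.cong) auto
      then show ?thesis by auto
    qed
    have "a \<noteq> 0"
      using coeff_a[of "l0 - 1"] l0 by (cases l0) auto
    moreover have "fabs (of_poly a) < exp (real M)"
      using fabs_less_exp_iff[of "of_poly a" "- int M"] by (auto simp: of_poly_nth coeff_a)
    moreover have "\<exists>b. fabs (of_poly a * vec_nth y i + of_poly b) < exp (- real N)" for i
    proof -
      let ?z = "of_poly a * vec_nth y i"
      have z_nth: "?z $$ m = (\<Sum>l\<in>{1..M}. c l * vec_nth y i $$ (m + int l - 1))" for m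
        unfolding a_def of_poly_sum sum_distrib_right of_poly_monom_mult fls_sum_nth
        by (intro sum.cong) (auto simp: of_nat_diff algebra_simps)
      have z0: "?z $$ (int m + 1) = 0" if "m < N" for m
      proof -
        \<comment> \<open>T^m has absolute value e^m < e^N, so this q is admissible exactly for m <
          N; this makes the digits 1 to N of \<open>?z\<close> vanish.\<close>
        define q where "q = (\<chi> j. if j = i then monom (1::'k) m else 0)"
        have "q \<in> Q"
          using that by (auto simp: Q_iff q_def fabs_of_poly degree_monom_eq)
        moreover have "e q l = vec_nth y i $$ (int m + int l)" for l
        proof -
          have "e q l = (\<Sum>j\<in>UNIV. if j = i then (of_poly (monom 1 m) * vec_nth y i) $$ int l else 0)"
            unfolding e_def dotp_nth by (intro sum.cong) (auto simp: q_def of_poly_vec_def mult.commute)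
          also have "\<dots> = (of_poly (monom 1 m) * vec_nth y i) $$ int l" by simp
          also have "\<dots> = vec_nth y i $$ (int m + int l)"
            unfolding of_poly_monom_mult by (simp add: add.commute)
          finally show ?thesis .
        qed
        ultimately show ?thesis using c(1)[of q] z_nth[of "int m + 1"] by simp
      qed
      obtain b where b: "\<And>m. m \<le> 0 \<Longrightarrow> of_poly b $$ m = ?z $$ m"
        using ex_of_poly_polynomial_part[of ?z] by metis
      have "(?z + of_poly (- b)) $$ m = 0" if "m \<le> int N" for m
      proof (cases "m \<le> 0")
        case True
        then show ?thesis using b by (simp add: of_poly_minus)
      next
        case False
        then have "m = int (nat (m - 1)) + 1" "nat (m - 1) < N" using that by auto
        then have "?z $$ m = 0" using z0 by metis
        then show ?thesis using False by (simp add: of_poly_nth)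
      qed
      then show ?thesis
        using fabs_less_exp_iff[of "?z + of_poly (- b)" "int N"] by auto
    qed
    then obtain b where "\<And>i. fabs (of_poly a * vec_nth y i + of_poly (b i)) < exp (- real N)" by metis
    ultimately show False using no by blast
  qed
  then obtain q where q: "q \<in> Q" "\<And>l. l \<in> {1..M} \<Longrightarrow> e q l = u l" by blast
  let ?z = "dotp y (of_poly_vec q) - \<theta>"
  obtain p where p: "\<And>m. m \<le> 0 \<Longrightarrow> of_poly p $$ m = ?z $$ m"
    using ex_of_poly_polynomial_part[of ?z] by metis
  have "e q M = 1" using q(2)[of M] M by (simp add: u_def)
  then have "q \<noteq> 0" using e0 by auto
  moreover have "(?z - of_poly p) $$ m = 0" if "m \<le> int (M - 1)" for m
  proof (cases "m \<le> 0")
    case True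
    then show ?thesis using p by simp
  next
    case False
    then have "nat m \<in> {1..M}" "nat m \<noteq> M" "m = int (nat m)" using that M by auto
    then have "dotp y (of_poly_vec q) $$ m = \<theta> $$ m"
      using q(2)[of "nat m"] by (simp add: e_def u_def)
    then show ?thesis using False by (simp add: of_poly_nth)
  qed
  then have "fabs (?z - of_poly p) < exp (- (real M - 1))"
    using fabs_less_exp_iff[of "?z - of_poly p" "int (M - 1)"] M by (auto simp: of_nat_diff)
  moreover have "?z - of_poly p = dotp y (of_poly_vec q) - of_poly p - \<theta>" by simp
  ultimately show ?thesis using that[of q p] q(1) by (simp add: Q_def)
qed

section \<open>Haar measure of balls\<close>

lemma outer_measure_of_Un_le:
  assumes "space M = UNIV"
  shows "outer_measure_of M (A \<union> B) \<le> outer_measure_of M A + outer_measure_of M B"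
proof -
  obtain E F where E: "E \<in> sets M" "A \<subseteq> E" "outer_measure_of M A = emeasure M E"
    and F: "F \<in> sets M" "B \<subseteq> F" "outer_measure_of M B = emeasure M F"
    using outer_measure_of_attain[of A M] outer_measure_of_attain[of B M] assms by auto
  have "outer_measure_of M (A \<union> B) \<le> outer_measure_of M (E \<union> F)"
    using E F by (intro outer_measure_of_mono) auto
  also have "\<dots> \<le> emeasure M E + emeasure M F"
    using E F by (simp add: emeasure_subadditive)
  finally show ?thesis using E F by simp
qed

lemma outer_measure_of_eq_0_iff:
  assumes "space M = UNIV"
  shows "outer_measure_of M A = 0 \<longleftrightarrow> (\<exists>N\<in>null_sets M. A \<subseteq> N)"
proof
  assume "outer_measure_of M A = 0"
  then show "\<exists>N\<in>null_sets M. A \<subseteq> N"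
    using outer_measure_of_attain[of A M] assms by (auto simp: null_sets_def)
next
  assume "\<exists>N\<in>null_sets M. A \<subseteq> N"
  then obtain N where "N \<in> null_sets M" "A \<subseteq> N" by blast
  then show "outer_measure_of M A = 0"
    using outer_measure_of_mono[of A N M] by (auto simp: null_sets_def)
qed

lemma outer_measure_of_UN_eq_0:
  assumes "space M = UNIV" "countable I" "\<And>i. i \<in> I \<Longrightarrow> outer_measure_of M (A i) = 0"
  shows "outer_measure_of M (\<Union>i\<in>I. A i) = 0"
proof -
  have "\<forall>i\<in>I. \<exists>N\<in>null_sets M. A i \<subseteq> N"
    using assms outer_measure_of_eq_0_iff[OF assms(1)] by blast
  then obtain N where "\<And>i. i \<in> I \<Longrightarrow> N i \<in> null_sets M \<and> A i \<subseteq> N i" by metis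
  then have "(\<Union>i\<in>I. N i) \<in> null_sets M" "(\<Union>i\<in>I. A i) \<subseteq> (\<Union>i\<in>I. N i)"
    using assms(2) by (auto intro: null_sets_UN')
  then show ?thesis using outer_measure_of_eq_0_iff[OF assms(1)] by blast
qed

lemma outer_measure_of_le_completion:
  assumes "A \<in> sets (completion M)"
  shows "outer_measure_of M A \<le> emeasure (completion M) A"
proof -
  obtain B where B: "B \<in> sets M" "A \<subseteq> B" "emeasure (completion M) A = emeasure M B"
    using completion_upper[OF assms] by metis
  then show ?thesis
    using outer_measure_of_mono[of A B M] by simp
qed

text \<open>Each piece of A is replaced by a measurable hull cut down to its cell. These are
  disjoint and measurable, so countable additivity is available although A need not be
  measurable.\<close>

lemma outer_measure_of_le_if_disjoint_cover:
  assumes "space M = UNIV" "countable X" "X \<subseteq> sets M" "disjoint X" "A \<subseteq> \<Union>X" "\<Union>X \<subseteq> G" "G \<in> sets M"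
    and le: "\<And>B. B \<in> X \<Longrightarrow> outer_measure_of M (A \<inter> B) \<le> c * emeasure M B"
  shows "outer_measure_of M A \<le> c * emeasure M G"
proof -
  have "\<exists>E\<in>sets M. A \<inter> B \<subseteq> E \<and> outer_measure_of M (A \<inter> B) = emeasure M E" for B
    by (rule outer_measure_of_attain) (simp add: assms(1))
  then obtain E where E: "\<And>B. E B \<in> sets M" "\<And>B. A \<inter> B \<subseteq> E B"
    "\<And>B. outer_measure_of M (A \<inter> B) = emeasure M (E B)" by metis
  have dis: "disjoint_family_on (\<lambda>B. E B \<inter> B) X" "disjoint_family_on (\<lambda>B. B) X"
    using assms(4) by (auto simp: disjoint_family_on_def disjoint_def)
  have "outer_measure_of M A \<le> outer_measure_of M (\<Union>B\<in>X. E B \<inter> B)"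
    using assms(5) E(2) by (intro outer_measure_of_mono) blast
  also have "\<dots> = emeasure M (\<Union>B\<in>X. E B \<inter> B)"
    using assms(2,3) E(1) by (intro outer_measure_of_eq sets.countable_UN') auto
  also have "\<dots> = (\<integral>\<^sup>+ B. emeasure M (E B \<inter> B) \<partial>count_space X)"
    using assms(2,3) E(1) dis(1) by (intro emeasure_UN_countable) auto
  also have "\<dots> \<le> (\<integral>\<^sup>+ B. c * emeasure M B \<partial>count_space X)"
  proof (rule nn_integral_mono)
    fix B assume "B \<in> space (count_space X)"
    then have "B \<in> X" by simp
    have "emeasure M (E B \<inter> B) \<le> emeasure M (E B)"
      using E(1) by (intro emeasure_mono) auto
    then show "emeasure M (E B \<inter> B) \<le> c * emeasure M B"
      using le[OF \<open>B \<in> X\<close>] E(3)[of B] by simp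
  qed
  also have "\<dots> = c * (\<integral>\<^sup>+ B. emeasure M B \<partial>count_space X)"
    by (rule nn_integral_cmult) simp
  also have "(\<integral>\<^sup>+ B. emeasure M B \<partial>count_space X) = emeasure M (\<Union>B\<in>X. B)"
    using assms(2,3) dis(2) by (intro emeasure_UN_countable[symmetric]) auto
  also have "c * \<dots> \<le> c * emeasure M G"
    using assms(6,7) by (intro mult_left_mono emeasure_mono) auto
  finally show ?thesis .
qed

section \<open>Ultrametric balls\<close>

definition Bl :: "int \<Rightarrow> ('k::{field,finite} fls) ^ 'd \<Rightarrow> (('k fls) ^ 'd) set" where
  "Bl k x = {y. \<forall>i. \<forall>m\<le>k. vec_nth y i $$ m = vec_nth x i $$ m}"

text \<open>Balls are indexed by the number of the last digit on which they agree, so larger k means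
  a smaller ball, and strict inequalities become equalities of digits.\<close>

lemma Bl_eq_supball: "Bl k x = supball x (exp (- real_of_int k))"
  by (auto simp: Bl_def supball_def supnorm_less_iff fabs_less_exp_iff)

lemma center_in_Bl [simp]: "x \<in> Bl k x"
  by (simp add: Bl_def)

lemma Bl_eqI: "y \<in> Bl k x \<Longrightarrow> Bl k y = Bl k x"
  by (auto simp: Bl_def)

lemma Bl_mono: "k \<le> l \<Longrightarrow> Bl l x \<subseteq> Bl k x"
  by (auto simp: Bl_def)

lemma Bl_subset: "y \<in> Bl k x \<Longrightarrow> k \<le> l \<Longrightarrow> Bl l y \<subseteq> Bl k x"
  using Bl_mono Bl_eqI by metis

lemma Bl_disjoint: "y \<notin> Bl k x \<Longrightarrow> Bl k y \<subseteq> - Bl k x"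
proof
  fix z assume "y \<notin> Bl k x" "z \<in> Bl k y"
  then have "Bl k z \<noteq> Bl k x" using Bl_eqI[of z k y] center_in_Bl[of y k] by auto
  then show "z \<in> - Bl k x" using Bl_eqI by blast
qed

lemma open_Bl: "open (Bl k x)"
  unfolding open_iff_supball
  by (metis Bl_eqI Bl_eq_supball exp_gt_zero order_refl)

lemma open_iff_Bl: "open U \<longleftrightarrow> (\<forall>x\<in>U. \<exists>n::nat. Bl (k0 + int n) x \<subseteq> U)"
proof
  assume U: "open U"
  show "\<forall>x\<in>U. \<exists>n::nat. Bl (k0 + int n) x \<subseteq> U"
  proof
    fix x assume "x \<in> U"
    then obtain r where r: "r > 0" "supball x r \<subseteq> U"
      using U unfolding open_iff_supball by blast
    obtain n where n: "- ln r - real_of_int k0 < real n" using reals_Archimedean2 by blast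
    then have "exp (- real_of_int (k0 + int n)) < exp (ln r)" by simp
    then have "Bl (k0 + int n) x \<subseteq> supball x r"
      using r(1) by (auto simp: Bl_eq_supball supball_def)
    then show "\<exists>n::nat. Bl (k0 + int n) x \<subseteq> U" using r(2) by blast
  qed
next
  assume "\<forall>x\<in>U. \<exists>n::nat. Bl (k0 + int n) x \<subseteq> U"
  then show "open U"
    unfolding open_iff_supball Bl_eq_supball by (metis exp_gt_zero)
qed

definition digit_vec :: "int \<Rightarrow> 'k ^ 'd \<Rightarrow> ('k::{field,finite} fls) ^ 'd" where
  "digit_vec k c = (\<chi> i. fls_shift (- k) (fls_const (vec_nth c i)))"

text \<open>The next digit of each of the d coordinates is free, which gives q^d children, one for
  each c.\<close>

lemma Bl_children: "Bl k x = (\<Union>c. Bl (k + 1) (x + digit_vec (k + 1) c))"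
proof (intro equalityI subsetI)
  fix y assume y: "y \<in> Bl k x"
  let ?c = "\<chi> i. vec_nth y i $$ (k + 1) - vec_nth x i $$ (k + 1)"
  have "vec_nth y i $$ m = vec_nth (x + digit_vec (k + 1) ?c) i $$ m" if "m \<le> k + 1" for i m
  proof (cases "m = k + 1")
    case False
    then have "m \<le> k" using that by simp
    then show ?thesis using y by (auto simp: Bl_def digit_vec_def)
  qed (simp add: digit_vec_def)
  then have "y \<in> Bl (k + 1) (x + digit_vec (k + 1) ?c)" unfolding Bl_def by blast
  then show "y \<in> (\<Union>c. Bl (k + 1) (x + digit_vec (k + 1) c))" by blast
qed (auto simp: Bl_def digit_vec_def)

lemma finite_subballs: "finite (Bl (k + int n) ` Bl k x)"
proof (induction n arbitrary: x k)
  case 0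
  have "Bl k ` Bl k x \<subseteq> {Bl k x}" by (auto dest: Bl_eqI)
  then show ?case using finite_subset by auto
next
  case (Suc n)
  have "Bl (k + int (Suc n)) ` Bl k x =
      (\<Union>c. Bl ((k + 1) + int n) ` Bl (k + 1) (x + digit_vec (k + 1) c))"
    unfolding Bl_children[of k x] by (simp add: image_UN add.assoc)
  then show ?case using Suc by simp
qed

lemma ex_Bl_0: "\<exists>n::nat. (x :: ('k::{field,finite} fls) ^ 'd) \<in> Bl (- int n) 0"
proof -
  define N where "N = (\<Sum>i\<in>UNIV. nat (1 - fls_subdegree (vec_nth x i)))"
  have "nat (1 - fls_subdegree (vec_nth x i)) \<le> N" for i
    unfolding N_def by (rule member_le_sum) auto
  then have "vec_nth x i $$ m = 0" if "m \<le> - int N" for i m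
    using that by (intro fls_eq0_below_subdegree) (smt (verit) nat_le_iff)
  then show ?thesis by (auto simp: Bl_def)
qed

text \<open>Every ball is one of the finitely many of its level inside some ball around 0.
  Countability makes families of disjoint balls summable and lets local null sets be united.\<close>

lemma countable_balls: "countable {B :: (('k::{field,finite} fls) ^ 'd) set. \<exists>k x. B = Bl k x}"
proof -
  have "{B :: (('k fls) ^ 'd) set. \<exists>k x. B = Bl k x} \<subseteq> (\<Union>n::nat. \<Union>m::nat. Bl (- int n + int m) ` Bl (- int n) 0)"
  proof clarify
    fix k and x :: "('k fls) ^ 'd"
    obtain n where n: "x \<in> Bl (- int n) 0" using ex_Bl_0 by blast
    define n' where "n' = max n (nat (- k))"
    have "x \<in> Bl (- int n') 0" using n Bl_mono[of "- int n'" "- int n" 0] by (auto simp: n'_def)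
    moreover obtain m where "k = - int n' + int m"
      using zle_iff_zadd[of "- int n'" k] by (auto simp: n'_def)
    ultimately show "Bl k x \<in> (\<Union>n::nat. \<Union>m::nat. Bl (- int n + int m) ` Bl (- int n) 0)"
      by blast
  qed
  then show ?thesis
    by (rule countable_subset) (intro countable_UN countableI_type countable_finite finite_subballs)
qed

text \<open>Two balls with a common point are nested, so the largest balls with property P around
  the points of A are equal or disjoint. The covering has no overlap, and no covering constant
  appears.\<close>

lemma maximal_balls:
  assumes "\<And>x. x \<in> A \<Longrightarrow> \<exists>n::nat. P (Bl (k0 + int n) x)"
  obtains X where "countable X" "disjoint X" "A \<subseteq> \<Union>X"
    "\<And>B. B \<in> X \<Longrightarrow> \<exists>x\<in>A. \<exists>n::nat. B = Bl (k0 + int n) x \<and> P B \<and> (\<forall>m<n. \<not> P (Bl (k0 + int m) x))"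
proof -
  define l where "l x = (LEAST n. P (Bl (k0 + int n) x))" for x
  have l: "P (Bl (k0 + int (l x)) x)" if "x \<in> A" for x
    using assms[OF that] unfolding l_def by (rule LeastI_ex)
  have l_min: "\<not> P (Bl (k0 + int m) x)" if "m < l x" for m x
    using that not_less_Least unfolding l_def by blast
  define X where "X = (\<lambda>x. Bl (k0 + int (l x)) x) ` A"
  have "Bl (k0 + int (l x)) x = Bl (k0 + int (l y)) y"
    if "x \<in> A" "y \<in> A" "z \<in> Bl (k0 + int (l x)) x" "z \<in> Bl (k0 + int (l y)) y" for x y z
  proof -
    have *: "l x \<le> l y" if "x \<in> A" "y \<in> A" "z \<in> Bl (k0 + int (l x)) x" "z \<in> Bl (k0 + int (l y)) y" for x y
    proof (rule ccontr)
      assume "\<not> l x \<le> l y"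
      then have "z \<in> Bl (k0 + int (l y)) x" "\<not> P (Bl (k0 + int (l y)) x)"
        using that Bl_mono[of "k0 + int (l y)" "k0 + int (l x)" x] l_min by auto
      then show False using l[OF \<open>y \<in> A\<close>] that Bl_eqI by metis
    qed
    then have "l x = l y" using that by (meson order_antisym)
    then show ?thesis using that Bl_eqI by metis
  qed
  then have "disjoint X" unfolding X_def disjoint_def by blast
  moreover have "countable X"
    by (rule countable_subset[OF _ countable_balls]) (auto simp: X_def)
  moreover have "A \<subseteq> \<Union>X" by (auto simp: X_def)
  moreover have "\<exists>x\<in>A. \<exists>n::nat. B = Bl (k0 + int n) x \<and> P B \<and> (\<forall>m<n. \<not> P (Bl (k0 + int m) x))"
    if "B \<in> X" for B
    using that l l_min unfolding X_def by blast
  ultimately show ?thesis using that[of X] by blast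
qed

section \<open>Translation invariant measures\<close>

locale haar_measure =
  fixes \<mu> :: "(('k::{field,finite} fls) ^ 'd) measure"
  assumes haar: "is_haar \<mu>"
begin

lemma sets_haar: "sets \<mu> = sets borel"
  using haar by (simp add: is_haar_def)

lemma space_haar: "space \<mu> = UNIV"
  using sets_eq_imp_space_eq[OF sets_haar] by simp

lemma open_in_sets: "open G \<Longrightarrow> G \<in> sets \<mu>"
  by (simp add: sets_haar)

lemma Bl_in_sets [simp]: "Bl k x \<in> sets \<mu>"
  by (simp add: open_in_sets open_Bl)

lemma emeasure_Bl_eq: "emeasure \<mu> (Bl k x) = emeasure \<mu> (Bl k 0)"
proof -
  have "(\<lambda>y. x + y) ` Bl k 0 = Bl k x"
  proof (intro equalityI subsetI)
    fix y assume "y \<in> Bl k x"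
    then have "y - x \<in> Bl k 0" by (simp add: Bl_def)
    then show "y \<in> (\<lambda>y. x + y) ` Bl k 0" by (intro image_eqI[of _ _ "y - x"]) auto
  qed (auto simp: Bl_def)
  then show ?thesis
    using haar unfolding is_haar_def by (metis Bl_in_sets sets_haar)
qed

text \<open>All children have the same measure by translation invariance. The factor q^d is the
  constant \<open>D\<close> of \<open>nondiv_const\<close>.\<close>

lemma emeasure_Bl_step:
  "emeasure \<mu> (Bl k x) \<le> of_nat CARD('k ^ 'd) * emeasure \<mu> (Bl (k + 1) y)"
proof -
  have "emeasure \<mu> (Bl k x) \<le> (\<Sum>c\<in>(UNIV :: ('k ^ 'd) set). emeasure \<mu> (Bl (k + 1) (x + digit_vec (k + 1) c)))"
    unfolding Bl_children[of k x] by (rule emeasure_subadditive_finite) auto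
  also have "\<dots> = of_nat CARD('k ^ 'd) * emeasure \<mu> (Bl (k + 1) y)"
    by (simp add: emeasure_Bl_eq[of "k + 1" "x + _"] emeasure_Bl_eq[of "k + 1" y])
  finally show ?thesis .
qed

lemma emeasure_Bl_step_n:
  "emeasure \<mu> (Bl k x) \<le> of_nat (CARD('k ^ 'd) ^ n) * emeasure \<mu> (Bl (k + int n) x)"
proof (induction n)
  case (Suc n)
  have "emeasure \<mu> (Bl (k + int n) x) \<le> of_nat CARD('k ^ 'd) * emeasure \<mu> (Bl (k + int (Suc n)) x)"
    using emeasure_Bl_step[of "k + int n" x x] by (simp add: ac_simps)
  then have "of_nat (CARD('k ^ 'd) ^ n) * emeasure \<mu> (Bl (k + int n) x)
      \<le> of_nat (CARD('k ^ 'd) ^ n) * (of_nat CARD('k ^ 'd) * emeasure \<mu> (Bl (k + int (Suc n)) x))"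
    by (intro mult_left_mono) auto
  with Suc show ?case by (simp add: ac_simps)
qed simp

text \<open>Absolute values are 0 or integral powers of e, so being at most 1 means being less than
  e; this is level -1 in the strict convention.\<close>

lemma emeasure_unit_ball: "emeasure \<mu> (Bl (- 1) 0) = 1"
proof -
  have "supnorm x \<le> 1 \<longleftrightarrow> (\<forall>i. fabs (vec_nth x i) \<le> 1)" for x :: "('k fls) ^ 'd"
    unfolding supnorm_def by (subst Max_le_iff) auto
  moreover have "fabs a \<le> 1 \<longleftrightarrow> fabs a < exp (- real_of_int (- 1))" for a :: "'k fls"
    by (auto simp: fabs_def)
  ultimately have "{x. supnorm x \<le> 1} = Bl (- 1) (0 :: ('k fls) ^ 'd)"
    by (simp add: Bl_eq_supball supball_def supnorm_less_iff)
  then show ?thesis using haar by (simp add: is_haar_def)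
qed

text \<open>Finiteness comes from the normalisation: level k + \<open>nat (- k)\<close> is max(k,
  0), where balls lie in translates of the unit ball, and finitely many of them fill the given
  ball.\<close>

lemma emeasure_Bl_finite: "emeasure \<mu> (Bl k x) < \<infinity>"
proof -
  have "emeasure \<mu> (Bl k x) \<le> of_nat (CARD('k ^ 'd) ^ (nat (- k))) * emeasure \<mu> (Bl (k + int (nat (- k))) x)"
    by (rule emeasure_Bl_step_n)
  also have "emeasure \<mu> (Bl (k + int (nat (- k))) x) \<le> emeasure \<mu> (Bl (- 1) x)"
    by (intro emeasure_mono Bl_mono) auto
  also have "\<dots> = 1" using emeasure_Bl_eq[of "- 1" x] emeasure_unit_ball by simp
  also have "of_nat (CARD('k ^ 'd) ^ (nat (- k))) * 1 < (\<infinity> :: ennreal)"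
    by (simp only: mult_1_right of_nat_less_top infinity_ennreal_def)
  finally show ?thesis by (simp add: mult_left_mono)
qed

lemma outer_measure_of_le_if_balls:
  assumes "\<And>x. x \<in> A \<Longrightarrow> \<exists>n::nat. P (Bl (k0 + int n) x)"
    and "\<And>x n. x \<in> A \<Longrightarrow> P (Bl (k0 + int n) x) \<Longrightarrow> Bl (k0 + int n) x \<subseteq> G"
    and "\<And>x n. x \<in> A \<Longrightarrow> P (Bl (k0 + int n) x) \<Longrightarrow> (\<And>m. m < n \<Longrightarrow> \<not> P (Bl (k0 + int m) x)) \<Longrightarrow>
      outer_measure_of \<mu> (A \<inter> Bl (k0 + int n) x) \<le> c * emeasure \<mu> (Bl (k0 + int n) x)"
    and "G \<in> sets \<mu>"
  shows "outer_measure_of \<mu> A \<le> c * emeasure \<mu> G"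
proof -
  obtain X where X: "countable X" "disjoint X" "A \<subseteq> \<Union>X"
    "\<And>B. B \<in> X \<Longrightarrow> \<exists>x\<in>A. \<exists>n::nat. B = Bl (k0 + int n) x \<and> P B \<and> (\<forall>m<n. \<not> P (Bl (k0 + int m) x))"
    by (rule maximal_balls[of A P k0]) (erule assms(1), rule that)
  show ?thesis
  proof (rule outer_measure_of_le_if_disjoint_cover[OF space_haar X(1) _ X(2,3) _ assms(4)])
    show "X \<subseteq> sets \<mu>" using X(4) by fastforce
    show "\<Union>X \<subseteq> G" using X(4) assms(2) by blast
    show "outer_measure_of \<mu> (A \<inter> B) \<le> c * emeasure \<mu> B" if "B \<in> X" for B
      using X(4)[OF that] assms(3) by blast
  qed
qed

text \<open>Approximating N and its complement from outside at the same time makes the property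
  symmetric, so it passes to complements in the induction over the Borel sets.\<close>

lemma regular_in_ball:
  assumes "N \<in> sets \<mu>" "0 < e"
  shows "\<exists>G H. open G \<and> open H \<and> N \<subseteq> G \<and> Bl k x - N \<subseteq> H \<and> emeasure \<mu> (G \<inter> H \<inter> Bl k x) < e"
proof -
  have decseq_small: "\<exists>n. emeasure \<mu> (F n) < e"
    if F: "\<And>n. F n \<in> sets \<mu>" "\<And>n. F n \<subseteq> Bl k x" "decseq F" "emeasure \<mu> (\<Inter>n. F n) < e" for F and e :: ennreal
  proof -
    have "(\<lambda>n. emeasure \<mu> (F n)) \<longlonglongrightarrow> emeasure \<mu> (\<Inter>n. F n)"
    proof (rule Lim_emeasure_decseq)
      show "emeasure \<mu> (F n) \<noteq> \<infinity>" for n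
        using le_less_trans[OF emeasure_mono[OF F(2) Bl_in_sets] emeasure_Bl_finite, of n] by simp
    qed (use F in auto)
    then have "eventually (\<lambda>n. emeasure \<mu> (F n) < e) sequentially"
      using F(4) by (rule order_tendstoD)
    then show ?thesis by (auto simp: eventually_sequentially)
  qed
  have "N \<in> sigma_sets UNIV {S. open S}"
    using assms(1) unfolding sets_haar borel_def by (simp add: sets_measure_of)
  then have "\<forall>e>0. \<exists>G H. open G \<and> open H \<and> N \<subseteq> G \<and> Bl k x - N \<subseteq> H \<and> emeasure \<mu> (G \<inter> H \<inter> Bl k x) < e"
  proof induction
    case (Basic U)
    then have U: "open U" by simp
    show ?case
    proof (intro allI impI)
      fix e :: ennreal assume e: "0 < e"
      \<comment> \<open>Open neighbourhoods of the complement of U at scale n; as U is open, their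
        intersection misses U.\<close>
      define H where "H n = {y. \<not> Bl (int n) y \<subseteq> U}" for n :: nat
      have oH: "open (H n)" for n
        unfolding open_iff_Bl[where ?k0.0 = "int n"]
      proof
        fix y assume "y \<in> H n"
        then have "Bl (int n + int 0) y \<subseteq> H n" by (auto simp: H_def dest: Bl_eqI)
        then show "\<exists>m. Bl (int n + int m) y \<subseteq> H n" by blast
      qed
      have "(\<Inter>n. H n) \<inter> U = {}"
        using U unfolding open_iff_Bl[where ?k0.0 = 0] by (auto simp: H_def)
      then have "(\<Inter>n. U \<inter> H n \<inter> Bl k x) = {}" by auto
      moreover have "decseq (\<lambda>n. U \<inter> H n \<inter> Bl k x)"
      proof (rule decseq_SucI)
        show "U \<inter> H (Suc n) \<inter> Bl k x \<subseteq> U \<inter> H n \<inter> Bl k x" for n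
          using Bl_mono[of "int n" "int (Suc n)"] by (auto simp: H_def)
      qed
      moreover have "U \<inter> H n \<inter> Bl k x \<in> sets \<mu>" for n
        by (intro sets.Int open_in_sets open_Bl U oH)
      ultimately obtain n where "emeasure \<mu> (U \<inter> H n \<inter> Bl k x) < e"
        using decseq_small[of "\<lambda>n. U \<inter> H n \<inter> Bl k x" e] e by auto
      moreover have "Bl k x - U \<subseteq> H n" using center_in_Bl[of _ "int n"] unfolding H_def by blast
      ultimately show "\<exists>G H. open G \<and> open H \<and> U \<subseteq> G \<and> Bl k x - U \<subseteq> H \<and> emeasure \<mu> (G \<inter> H \<inter> Bl k x) < e"
        using U oH[of n] by (intro exI[of _ U] exI[of _ "H n"] conjI order_refl)
    qed
  next
    case Empty
    show ?case by (intro allI impI exI[of _ "{}"] exI[of _ UNIV] conjI) simp_all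
  next
    case (Compl N)
    show ?case
    proof (intro allI impI)
      fix e :: ennreal assume "0 < e"
      obtain G H where GH: "open G" "open H" "N \<subseteq> G" "Bl k x - N \<subseteq> H" "emeasure \<mu> (G \<inter> H \<inter> Bl k x) < e"
        using Compl.IH[rule_format, OF \<open>0 < e\<close>] by (elim exE conjE) (rule that)
      have "open (H \<union> - Bl k x)"
      proof (rule open_Un[OF GH(2)])
        show "open (- Bl k x)"
          unfolding open_iff_Bl[where ?k0.0 = k]
        proof
          fix y assume "y \<in> - Bl k x"
          then have "Bl (k + int 0) y \<subseteq> - Bl k x"
            using Bl_disjoint by simp
          then show "\<exists>n. Bl (k + int n) y \<subseteq> - Bl k x" by blast
        qed
      qed
      moreover have "(H \<union> - Bl k x) \<inter> G \<inter> Bl k x = G \<inter> H \<inter> Bl k x" by auto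
      ultimately show "\<exists>G H. open G \<and> open H \<and> UNIV - N \<subseteq> G \<and> Bl k x - (UNIV - N) \<subseteq> H \<and> emeasure \<mu> (G \<inter> H \<inter> Bl k x) < e"
        using GH by (intro exI[of _ "H \<union> - Bl k x"] exI[of _ G] conjI) auto
    qed
  next
    case (Union N)
    show ?case
    proof (intro allI impI)
      fix e :: ennreal assume e: "0 < e"
      obtain t where t: "0 < t" "t < e" using dense[OF e] by blast
      then obtain r where r: "0 < r" "ennreal r < e" by (cases t) auto
      have "\<exists>G H. open G \<and> open H \<and> N i \<subseteq> G \<and> Bl k x - N i \<subseteq> H \<and>
          emeasure \<mu> (G \<inter> H \<inter> Bl k x) < ennreal (r * (1/2) ^ Suc i)" for i
      proof -
        have "0 < ennreal (r * (1/2) ^ Suc i)" using r(1) by simp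
        then show ?thesis by (rule Union.IH[rule_format])
      qed
      then obtain G H where GH: "\<And>i. open (G i)" "\<And>i. open (H i)" "\<And>i. N i \<subseteq> G i" "\<And>i. Bl k x - N i \<subseteq> H i"
        "\<And>i. emeasure \<mu> (G i \<inter> H i \<inter> Bl k x) < ennreal (r * (1/2) ^ Suc i)" by metis
      \<comment> \<open>The intersection of all \<open>H i\<close> need not be open. A finite one
        is, and continuity from above shows that some finite n is enough.\<close>
      define F where "F n = (\<Union>i. G i) \<inter> (\<Inter>i\<le>n. H i) \<inter> Bl k x" for n :: nat
      have oH: "open (\<Inter>i\<le>n. H i)" for n :: nat using GH(2) by (intro open_INT) auto
      have oG: "open (\<Union>i. G i)" using GH(1) by blast
      have "emeasure \<mu> (\<Inter>n. F n) \<le> emeasure \<mu> (\<Union>i. G i \<inter> H i \<inter> Bl k x)"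
      proof (rule emeasure_mono)
        show "(\<Inter>n. F n) \<subseteq> (\<Union>i. G i \<inter> H i \<inter> Bl k x)" unfolding F_def by fastforce
        show "(\<Union>i. G i \<inter> H i \<inter> Bl k x) \<in> sets \<mu>"
          by (intro sets.countable_UN image_subsetI sets.Int open_in_sets open_Bl GH)
      qed
      also have "\<dots> \<le> (\<Sum>i. emeasure \<mu> (G i \<inter> H i \<inter> Bl k x))"
        using GH(1,2) by (intro emeasure_subadditive_countably image_subsetI sets.Int open_in_sets open_Bl)
      also have "\<dots> \<le> (\<Sum>i. ennreal (r * (1/2) ^ Suc i))"
        using GH(5) by (intro suminf_le) (auto intro: less_imp_le)
      also have "\<dots> = ennreal r"
      proof (rule suminf_ennreal_eq)
        show "(\<lambda>i. r * (1/2) ^ Suc i) sums r"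
          using sums_mult[OF power_half_series, of r] by simp
      qed (use r in simp)
      finally have "emeasure \<mu> (\<Inter>n. F n) < e" using r(2) by simp
      moreover have "F n \<in> sets \<mu>" for n
        unfolding F_def using oG oH[of n] by (intro sets.Int) (auto simp: open_in_sets)
      moreover have "decseq F" by (rule decseq_SucI) (auto simp: F_def)
      ultimately obtain n where n: "emeasure \<mu> (F n) < e"
        using decseq_small[of F e] by (auto simp: F_def)
      show "\<exists>G H. open G \<and> open H \<and> \<Union>(range N) \<subseteq> G \<and> Bl k x - \<Union>(range N) \<subseteq> H \<and> emeasure \<mu> (G \<inter> H \<inter> Bl k x) < e"
      proof (rule exI[of _ "\<Union>i. G i"], rule exI[of _ "\<Inter>i\<le>n. H i"], intro conjI)
        show "\<Union>(range N) \<subseteq> (\<Union>i. G i)" using GH(3) by blast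
        show "Bl k x - \<Union>(range N) \<subseteq> (\<Inter>i\<le>n. H i)" using GH(4) by blast
      qed (use oG oH[of n] n in \<open>simp_all add: F_def\<close>)
    qed
  qed
  then show ?thesis using assms(2) by blast
qed

lemma outer_regular:
  assumes "A \<subseteq> Bl k x" "0 < e"
  obtains G where "open G" "A \<subseteq> G" "emeasure \<mu> G \<le> outer_measure_of \<mu> A + e"
proof -
  obtain N where N: "N \<in> sets \<mu>" "A \<subseteq> N" "outer_measure_of \<mu> A = emeasure \<mu> N"
    using outer_measure_of_attain[of A \<mu>] space_haar by auto
  obtain G H where GH: "open G" "open H" "N \<subseteq> G" "Bl k x - N \<subseteq> H" "emeasure \<mu> (G \<inter> H \<inter> Bl k x) < e"
    using regular_in_ball[OF N(1) assms(2), of k x] by (elim exE conjE) (rule that)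
  have GH': "G \<inter> H \<inter> Bl k x \<in> sets \<mu>"
    by (intro sets.Int open_in_sets open_Bl GH)
  have "emeasure \<mu> (G \<inter> Bl k x) \<le> emeasure \<mu> (N \<union> (G \<inter> H \<inter> Bl k x))"
    using N(1) GH(4) GH' by (intro emeasure_mono sets.Un) auto
  also have "\<dots> \<le> emeasure \<mu> N + emeasure \<mu> (G \<inter> H \<inter> Bl k x)"
    using N(1) GH' by (rule emeasure_subadditive)
  also have "\<dots> \<le> outer_measure_of \<mu> A + e"
    using N(3) GH(5) by (intro add_mono) auto
  finally have "emeasure \<mu> (G \<inter> Bl k x) \<le> outer_measure_of \<mu> A + e" .
  then show ?thesis
    using that[of "G \<inter> Bl k x"] GH(1,3) N(2) assms(1) open_Bl by blast
qed

text \<open>A weak density theorem for sets that may be nonmeasurable. Covering A by balls inside an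
  open G of nearly the same measure gives m \<le> c (m + e) for every e > 0, where m is the outer
  measure; as c < 1 and m is finite, m = 0.\<close>

lemma outer_measure_of_eq_0_if_thin:
  assumes "A \<subseteq> Bl k x" "c < 1"
    and "\<And>y n. y \<in> A \<Longrightarrow> outer_measure_of \<mu> (A \<inter> Bl (k + int n) y) \<le> c * emeasure \<mu> (Bl (k + int n) y)"
  shows "outer_measure_of \<mu> A = 0"
proof -
  let ?m = "outer_measure_of \<mu> A"
  have le: "?m \<le> c * (?m + e)" if e: "0 < e" for e
  proof -
    obtain G where G: "open G" "A \<subseteq> G" "emeasure \<mu> G \<le> ?m + e"
      using outer_regular[OF assms(1) e] by blast
    have "?m \<le> c * emeasure \<mu> G"
    proof (rule outer_measure_of_le_if_balls[where P = "\<lambda>B. B \<subseteq> G" and ?k0.0 = k])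
      show "\<exists>n. Bl (k + int n) y \<subseteq> G" if "y \<in> A" for y
        using G(1,2) that open_iff_Bl by blast
    qed (use assms(3) G(1) open_in_sets in auto)
    also have "\<dots> \<le> c * (?m + e)" by (intro mult_left_mono G) auto
    finally show ?thesis .
  qed
  have "?m \<le> emeasure \<mu> (Bl k x)"
    using outer_measure_of_mono[OF assms(1), of \<mu>] by simp
  then have fin: "?m < \<infinity>" using emeasure_Bl_finite[of k x] by (meson le_less_trans)
  then obtain a where a: "?m = ennreal a" "0 \<le> a" by (cases ?m) auto
  obtain b where b: "c = ennreal b" "0 \<le> b" "b < 1"
    using assms(2) by (cases c) auto
  have "a \<le> b * (a + e)" if "0 < e" for e
    using le[of "ennreal e"] a b that by (simp flip: ennreal_plus ennreal_mult)
  then have "a \<le> 0 + e" if "0 < e" for e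
  proof -
    have "a \<le> b * (a + (1 - b) * e)" 
      using that b(3) \<open>\<And>e. 0 < e \<Longrightarrow> a \<le> b * (a + e)\<close>[of "(1 - b) * e"] by simp
    then have "(1 - b) * a \<le> (1 - b) * (b * e)" by (simp add: algebra_simps)
    then have "a \<le> b * e" using b(3) by simp
    also have "\<dots> \<le> 1 * e" using b that by (intro mult_right_mono) auto
    finally show ?thesis by simp
  qed
  then have "a \<le> 0" by (rule field_le_epsilon)
  then show ?thesis using a by simp
qed

end

section \<open>Quantitative nondivergence\<close>

text \<open>F plays the part of a flag. Its members are comparable with all of F, so their values
  lie between \<epsilon> and \<rho>; anything in S that could be added to the flag has value at
  least \<epsilon>.\<close>

definition marked :: "('p \<Rightarrow> 'p \<Rightarrow> bool) \<Rightarrow> ('p \<Rightarrow> 'x \<Rightarrow> real) \<Rightarrow> real \<Rightarrow> real \<Rightarrow> 'p set \<Rightarrow> 'x \<Rightarrow> bool" where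
  "marked cmp psi \<epsilon> \<rho> S x \<longleftrightarrow> (\<exists>F\<subseteq>S. finite F \<and> (\<forall>p\<in>F. \<forall>q\<in>F. cmp p q) \<and> (\<forall>p\<in>F. psi p x < \<rho>) \<and>
     (\<forall>p\<in>S. (\<forall>q\<in>F. cmp p q) \<longrightarrow> \<epsilon> \<le> psi p x))"

text \<open>One step of the induction adds 1 for the set where the chosen function is small, and
  multiplies by \<open>D\<close> for passing from a ball to its parent.\<close>

fun nondiv_const :: "nat \<Rightarrow> nat \<Rightarrow> nat" where
  "nondiv_const D 0 = 0"
| "nondiv_const D (Suc j) = D * (nondiv_const D j + 1)"

context haar_measure
begin

text \<open>
  Around a point where some \<open>psi p\<close> is below \<open>\<epsilon>\<close>, take the largest ball on which some \<open>psi p\<^sub>0\<close> stays below \<open>\<rho>\<close>.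
  On the next larger ball no \<open>psi p\<close> does, so the induction hypothesis applies there to the \<open>p\<close>
  that are comparable with \<open>p\<^sub>0\<close> and of a different rank; \<open>p\<^sub>0\<close> is then added to the marking chain.
\<close>

lemma nondivergence:
  fixes psi :: "'p \<Rightarrow> ('k fls) ^ 'd \<Rightarrow> real" and rk :: "'p \<Rightarrow> nat"
  assumes cmp: "\<And>p. cmp p p" "\<And>p q. cmp p q \<Longrightarrow> cmp q p"
    and rk: "\<And>p q. p \<in> P \<Longrightarrow> q \<in> P \<Longrightarrow> cmp p q \<Longrightarrow> rk p = rk q \<Longrightarrow> psi p = psi q"
    and P: "countable P" and c: "c < 1"
    and good: "\<And>p l y. p \<in> P \<Longrightarrow> Bl l y \<subseteq> Bl k0 x0 \<Longrightarrow> \<exists>z\<in>Bl l y. \<rho> \<le> psi p z \<Longrightarrow>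
      outer_measure_of \<mu> {z \<in> Bl l y. psi p z < \<epsilon>} \<le> c * emeasure \<mu> (Bl l y)"
    and "finite R" "S \<subseteq> P" "rk ` S \<subseteq> R" "Bl k x \<subseteq> Bl k0 x0" "\<And>p. p \<in> S \<Longrightarrow> \<exists>y\<in>Bl k x. \<rho> \<le> psi p y"
  shows "outer_measure_of \<mu> {z \<in> Bl k x. \<not> marked cmp psi \<epsilon> \<rho> S z}
    \<le> of_nat (nondiv_const CARD('k ^ 'd) (card R)) * c * emeasure \<mu> (Bl k x)"
  using assms(7-)
proof (induction "card R" arbitrary: R S k x)
  case 0
  then have "S = {}" by auto
  then have "marked cmp psi \<epsilon> \<rho> S z" for z by (auto simp: marked_def)
  then show ?case by simp
next
  case (Suc j)
  let ?D = "of_nat CARD('k ^ 'd) :: ennreal"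
  let ?K = "of_nat (nondiv_const CARD('k ^ 'd) j) :: ennreal"
  let ?Z = "{z \<in> Bl k x. \<not> marked cmp psi \<epsilon> \<rho> S z}"
  \<comment> \<open>As \<open>psi p\<close> need not be continuous, it may reach \<open>\<rho>\<close> in every ball around a point where it is small.
    Such points have density less than \<open>1\<close> in every ball around them.\<close>
  define noball where "noball p = {z \<in> Bl k x. psi p z < \<epsilon> \<and> (\<forall>n. \<exists>y\<in>Bl (k + int n) z. \<rho> \<le> psi p y)}" for p
  define P1 where "P1 B \<longleftrightarrow> (\<exists>p\<in>S. \<forall>y\<in>B. psi p y < \<rho>)" for B
  define N where "N = (\<Union>p\<in>S. noball p)"
  have sub: "Bl (k + int n) z \<subseteq> Bl k x" if "z \<in> Bl k x" for n z
    using that by (intro Bl_subset) auto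
  have "outer_measure_of \<mu> (noball p) = 0" if p: "p \<in> S" for p
  proof (rule outer_measure_of_eq_0_if_thin[OF _ c])
    show "noball p \<subseteq> Bl k x" by (auto simp: noball_def)
    fix y n assume y: "y \<in> noball p"
    have "outer_measure_of \<mu> (noball p \<inter> Bl (k + int n) y) \<le> outer_measure_of \<mu> {z \<in> Bl (k + int n) y. psi p z < \<epsilon>}"
      by (intro outer_measure_of_mono) (auto simp: noball_def)
    also have "\<dots> \<le> c * emeasure \<mu> (Bl (k + int n) y)"
    proof (rule good)
      show "p \<in> P" using p Suc.prems(2) by blast
      show "Bl (k + int n) y \<subseteq> Bl k0 x0"
        using y sub Suc.prems(4) unfolding noball_def by blast
      show "\<exists>z\<in>Bl (k + int n) y. \<rho> \<le> psi p z" using y unfolding noball_def by blast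
    qed
    finally show "outer_measure_of \<mu> (noball p \<inter> Bl (k + int n) y) \<le> c * emeasure \<mu> (Bl (k + int n) y)" .
  qed
  then have N: "outer_measure_of \<mu> N = 0"
    unfolding N_def using countable_subset[OF Suc.prems(2) P] space_haar
    by (intro outer_measure_of_UN_eq_0)
  have step: "outer_measure_of \<mu> (?Z \<inter> Bl (k + int n) z) \<le> ?D * (?K + 1) * c * emeasure \<mu> (Bl (k + int n) z)"
    if z: "z \<in> Bl k x" "P1 (Bl (k + int n) z)" "\<And>m. m < n \<Longrightarrow> \<not> P1 (Bl (k + int m) z)" for z n
  proof -
    obtain p0 where p0: "p0 \<in> S" "\<And>y. y \<in> Bl (k + int n) z \<Longrightarrow> psi p0 y < \<rho>"
      using z(2) unfolding P1_def by blast
    \<comment> \<open>On the starting ball every function reaches \<rho>, so a ball on which one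
      stays below \<rho> is strictly smaller and has a parent inside the starting ball.\<close>
    have "n \<noteq> 0"
    proof
      assume "n = 0"
      then have "Bl (k + int n) z = Bl k x" using z(1) Bl_eqI by simp
      then show False using Suc.prems(5)[OF p0(1)] p0(2) by force
    qed
    then obtain m where m: "n = Suc m" using not0_implies_Suc by blast
    let ?B = "Bl (k + int m) z"
    have B: "?B \<subseteq> Bl k0 x0" using sub[OF z(1)] Suc.prems(4) by blast
    have large: "\<exists>y\<in>?B. \<rho> \<le> psi p y" if "p \<in> S" for p
      using z(3)[of m] that m unfolding P1_def by (auto simp: not_less)
    define S' where "S' = {p \<in> S. cmp p p0 \<and> rk p \<noteq> rk p0}"
    have IH: "outer_measure_of \<mu> {z \<in> ?B. \<not> marked cmp psi \<epsilon> \<rho> S' z} \<le> ?K * c * emeasure \<mu> ?B"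
    proof -
      have R: "rk p0 \<in> R" using p0(1) Suc.prems(3) by blast
      then have j: "j = card (R - {rk p0})" using Suc.hyps(2) Suc.prems(1) by simp
      show ?thesis
        unfolding j
      proof (rule Suc.hyps(1)[OF j])
        show "finite (R - {rk p0})" using Suc.prems(1) by simp
        show "S' \<subseteq> P" "rk ` S' \<subseteq> R - {rk p0}" using Suc.prems(2,3) by (auto simp: S'_def)
        show "?B \<subseteq> Bl k0 x0" by (rule B)
        show "\<exists>y\<in>?B. \<rho> \<le> psi p y" if "p \<in> S'" for p using that large by (simp add: S'_def)
      qed
    qed
    have p0_small: "outer_measure_of \<mu> {z \<in> ?B. psi p0 z < \<epsilon>} \<le> c * emeasure \<mu> ?B"
      using good[OF _ B large[OF p0(1)]] p0(1) Suc.prems(2) by blast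
    have "?Z \<inter> Bl (k + int n) z \<subseteq> {z \<in> ?B. \<not> marked cmp psi \<epsilon> \<rho> S' z} \<union> {z \<in> ?B. psi p0 z < \<epsilon>}"
    proof
      fix y assume y: "y \<in> ?Z \<inter> Bl (k + int n) z"
      then have yB: "y \<in> ?B" using Bl_mono[of "k + int m" "k + int n" z] m by auto
      have "marked cmp psi \<epsilon> \<rho> S y" if "marked cmp psi \<epsilon> \<rho> S' y" "\<epsilon> \<le> psi p0 y"
      proof -
        obtain F where F: "F \<subseteq> S'" "finite F" "\<And>p q. p \<in> F \<Longrightarrow> q \<in> F \<Longrightarrow> cmp p q" "\<And>p. p \<in> F \<Longrightarrow> psi p y < \<rho>"
          "\<And>p. p \<in> S' \<Longrightarrow> (\<And>q. q \<in> F \<Longrightarrow> cmp p q) \<Longrightarrow> \<epsilon> \<le> psi p y"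
          using \<open>marked cmp psi \<epsilon> \<rho> S' y\<close> unfolding marked_def by metis
        show ?thesis
          unfolding marked_def
        proof (intro exI[of _ "insert p0 F"] conjI ballI impI)
          show "insert p0 F \<subseteq> S" using F(1) p0(1) by (auto simp: S'_def)
          show "finite (insert p0 F)" using F(2) by simp
          show "cmp p q" if "p \<in> insert p0 F" "q \<in> insert p0 F" for p q
            using that F(1,3) cmp by (auto simp: S'_def)
          show "psi p y < \<rho>" if "p \<in> insert p0 F" for p
            using that F(4) p0(2) y by auto
          show "\<epsilon> \<le> psi p y" if "p \<in> S" "\<forall>q\<in>insert p0 F. cmp p q" for p
          proof (cases "rk p = rk p0")
            case True
            \<comment> \<open>Comparable elements with the rank of \<open>p0\<close> are missing
              from \<open>S'\<close>, but they share the function of \<open>p0\<close>, which is at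
              least \<epsilon> at y.\<close>
            then have "psi p = psi p0" using rk[of p p0] that p0(1) Suc.prems(2) by auto
            then show ?thesis using \<open>\<epsilon> \<le> psi p0 y\<close> by simp
          next
            case False
            then have "p \<in> S'" using that by (auto simp: S'_def)
            then show ?thesis using F(5) that(2) by blast
          qed
        qed
      qed
      then show "y \<in> {z \<in> ?B. \<not> marked cmp psi \<epsilon> \<rho> S' z} \<union> {z \<in> ?B. psi p0 z < \<epsilon>}"
        using y yB by force
    qed
    then have "outer_measure_of \<mu> (?Z \<inter> Bl (k + int n) z)
        \<le> outer_measure_of \<mu> ({z \<in> ?B. \<not> marked cmp psi \<epsilon> \<rho> S' z} \<union> {z \<in> ?B. psi p0 z < \<epsilon>})"
      by (rule outer_measure_of_mono)
    also have "\<dots> \<le> outer_measure_of \<mu> {z \<in> ?B. \<not> marked cmp psi \<epsilon> \<rho> S' z} + outer_measure_of \<mu> {z \<in> ?B. psi p0 z < \<epsilon>}"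
      by (rule outer_measure_of_Un_le[OF space_haar])
    also have "\<dots> \<le> ?K * c * emeasure \<mu> ?B + c * emeasure \<mu> ?B"
      by (rule add_mono[OF IH p0_small])
    also have "\<dots> = (?K + 1) * c * emeasure \<mu> ?B"
      by (simp add: algebra_simps)
    \<comment> \<open>The estimates hold on the parent ball; comparing it with the maximal ball
      itself costs the factor \<open>?D\<close>.\<close>
    also have "\<dots> \<le> (?K + 1) * c * (?D * emeasure \<mu> (Bl (k + int n) z))"
      using emeasure_Bl_step[of "k + int m" z z] m by (intro mult_left_mono) (auto simp: ac_simps)
    finally show ?thesis by (simp only: ac_simps)
  qed
  have main: "outer_measure_of \<mu> (?Z - N) \<le> ?D * (?K + 1) * c * emeasure \<mu> (Bl k x)"
  proof (rule outer_measure_of_le_if_balls[where P = P1 and ?k0.0 = k])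
    show "\<exists>n. P1 (Bl (k + int n) z)" if z: "z \<in> ?Z - N" for z
    proof -
      have "\<not> (\<forall>p\<in>S. \<epsilon> \<le> psi p z)" using z unfolding marked_def by auto
      then obtain p where p: "p \<in> S" "psi p z < \<epsilon>" by (auto simp: not_le)
      then have "z \<notin> noball p" using z by (auto simp: N_def)
      then obtain n where "\<forall>y\<in>Bl (k + int n) z. psi p y < \<rho>"
        using z p(2) unfolding noball_def by (auto simp: not_le)
      then show ?thesis using p(1) unfolding P1_def by blast
    qed
    show "Bl (k + int n) z \<subseteq> Bl k x" if "z \<in> ?Z - N" for z n
      using that sub by blast
    show "outer_measure_of \<mu> ((?Z - N) \<inter> Bl (k + int n) z) \<le> ?D * (?K + 1) * c * emeasure \<mu> (Bl (k + int n) z)"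
      if z: "z \<in> ?Z - N" "P1 (Bl (k + int n) z)" "\<And>m. m < n \<Longrightarrow> \<not> P1 (Bl (k + int m) z)" for z n
    proof -
      have "outer_measure_of \<mu> ((?Z - N) \<inter> Bl (k + int n) z) \<le> outer_measure_of \<mu> (?Z \<inter> Bl (k + int n) z)"
        by (intro outer_measure_of_mono) auto
      also have "\<dots> \<le> ?D * (?K + 1) * c * emeasure \<mu> (Bl (k + int n) z)"
        by (rule step) (use z in auto)
      finally show ?thesis .
    qed
  qed simp
  have "outer_measure_of \<mu> ?Z \<le> outer_measure_of \<mu> ((?Z - N) \<union> N)"
    by (intro outer_measure_of_mono) auto
  also have "\<dots> \<le> outer_measure_of \<mu> (?Z - N) + outer_measure_of \<mu> N"
    by (rule outer_measure_of_Un_le[OF space_haar])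
  also have "\<dots> \<le> ?D * (?K + 1) * c * emeasure \<mu> (Bl k x)" using main N by simp
  also have "?D * (?K + 1) = of_nat (nondiv_const CARD('k ^ 'd) (card R))"
    by (simp add: algebra_simps flip: Suc.hyps(2))
  finally show ?case .
qed

end

section \<open>Rational subspaces\<close>

lemma sum_UNIV_option:
  fixes g :: "'n::finite option \<Rightarrow> 'a::comm_monoid_add"
  shows "(\<Sum>i\<in>UNIV. g i) = g None + (\<Sum>i\<in>UNIV. g (Some i))"
  by (simp add: UNIV_option_conv sum.reindex)

text \<open>
  The pair \<open>(a, b) \<in> F \<times> F\<^sup>n\<close> is encoded as the vector with \<^const>\<open>None\<close>-component \<open>a\<close>
  and \<^term>\<open>Some i\<close>-components \<open>b\<^sub>i\<close>. The unipotent map \<open>(a, b) \<mapsto> (a, b + a y)\<close> acts on multivectors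
  by \<open>transv_at y\<close>.
\<close>

definition e0 :: "'n::finite option \<Rightarrow> 'a::comm_ring_1" where
  "e0 i = (if i = None then 1 else 0)"

definition ext0 :: "'a::comm_ring_1 ^ 'n \<Rightarrow> 'n::finite option \<Rightarrow> 'a" where
  "ext0 y = case_option 0 (vec_nth y)"

lemma ext0_simps [simp]: "ext0 y None = 0" "ext0 y (Some i) = vec_nth y i"
  by (simp_all add: ext0_def)

abbreviation transv_at :: "'a::comm_ring_1 ^ 'n \<Rightarrow> ('n::finite option, 'a) mvec \<Rightarrow> ('n option, 'a) mvec" where
  "transv_at y \<equiv> transv e0 (ext0 y)"

lemma pair_e0 [simp]: "pair e0 v = v None"
  by (simp add: pair_def sum_UNIV_option e0_def)

lemma contr_e0: "contr e0 w S = (if None \<in> S then 0 else sg None S * w (insert None S))"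
proof -
  have "contr e0 w S = (\<Sum>k\<in>- S. if k = None then sg k S * w (insert k S) else 0)"
    unfolding contr_def by (intro sum.cong) (auto simp: e0_def)
  then show ?thesis by simp
qed

text \<open>The coefficients of y in the coordinate S of the unipotent image of w.\<close>

definition transv_coeff :: "('n::finite option, 'a::comm_ring_1) mvec \<Rightarrow> 'n option set \<Rightarrow> 'a ^ 'n" where
  "transv_coeff w S = (\<chi> i. if Some i \<in> S then sg (Some i) S * contr e0 w (S - {Some i}) else 0)"

lemma transv_at_eq: "transv_at y w S = w S + (\<Sum>i\<in>UNIV. vec_nth (transv_coeff w S) i * vec_nth y i)"
proof -
  have "wdg (ext0 y) (contr e0 w) S =
      (\<Sum>i\<in>UNIV. if i \<in> S then sg i S * ext0 y i * contr e0 w (S - {i}) else 0)"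
    unfolding wdg_def by (simp add: sum.If_cases)
  also have "\<dots> = (\<Sum>i\<in>UNIV. vec_nth (transv_coeff w S) i * vec_nth y i)"
    unfolding sum_UNIV_option by (auto simp: transv_coeff_def intro!: sum.cong)
  finally show ?thesis by (simp add: transv_def)
qed

section \<open>The diagonal flow and the norm of a multivector\<close>

definition wt1 :: "real \<Rightarrow> 'n::finite option \<Rightarrow> real" where
  "wt1 t i = (if i = None then exp (- (real CARD('n) * t)) else exp t)"

definition wt :: "real \<Rightarrow> 'n::finite option set \<Rightarrow> real" where
  "wt t S = (\<Prod>i\<in>S. wt1 t i)"

lemma wt1_pos: "0 < wt1 t i"
  by (simp add: wt1_def)

lemma wt_pos: "0 < wt t S"
  unfolding wt_def by (intro prod_pos wt1_pos)

lemma wt_empty [simp]: "wt t {} = 1"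
  by (simp add: wt_def)

lemma wt_remove: "i \<in> S \<Longrightarrow> wt t S = wt1 t i * wt t (S - {i})"
  unfolding wt_def by (simp add: prod.remove)

text \<open>Only the component \<open>None\<close> is contracted by the flow, so coordinates
  avoiding it bound the norm from below independently of t.\<close>

lemma wt_ge_1: "None \<notin> S \<Longrightarrow> 0 \<le> t \<Longrightarrow> 1 \<le> wt t S"
  unfolding wt_def by (intro prod_ge_1) (auto simp: wt1_def)

lemma wt_UNIV: "wt t (UNIV :: 'n::finite option set) = 1"
proof -
  have "wt t (UNIV :: 'n option set) = exp (- (real CARD('n) * t)) * (\<Prod>i\<in>(UNIV :: 'n set). exp t)"
    unfolding wt_def UNIV_option_conv
    by (subst prod.insert) (auto simp: prod.reindex wt1_def)
  also have "\<dots> = 1" by (simp flip: exp_of_nat_mult exp_add)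
  finally show ?thesis .
qed

text \<open>The supremum norm after the unipotent map followed by the diagonal flow. At the
  representatives of rational subspaces it is the covolume function.\<close>

definition wnorm :: "real \<Rightarrow> ('k::{field,finite} fls) ^ 'n \<Rightarrow> ('n::finite option, 'k fls) mvec \<Rightarrow> real" where
  "wnorm t y w = Max (range (\<lambda>S. wt t S * fabs (transv_at y w S)))"

lemma wnorm_less_iff: "wnorm t y w < r \<longleftrightarrow> (\<forall>S. wt t S * fabs (transv_at y w S) < r)"
  unfolding wnorm_def by (subst Max_less_iff) auto

lemma wnorm_le_iff: "wnorm t y w \<le> r \<longleftrightarrow> (\<forall>S. wt t S * fabs (transv_at y w S) \<le> r)"
  unfolding wnorm_def by (subst Max_le_iff) auto

lemma wnorm_scale: "wnorm t y (\<lambda>S. c * w S) = fabs c * wnorm t y w"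
proof -
  have "wnorm t y (\<lambda>S. c * w S) = Max ((\<lambda>r. fabs c * r) ` range (\<lambda>S. wt t S * fabs (transv_at y w S)))"
    unfolding wnorm_def by (simp add: transv_scale fabs_mult image_image mult.left_commute)
  also have "\<dots> = fabs c * wnorm t y w"
    unfolding wnorm_def by (intro mono_Max_commute[symmetric] monoI mult_left_mono) auto
  finally show ?thesis .
qed

lemma fabs_sg [simp]: "fabs (sg i S) = 1"
  by (simp add: sg_def minus_one_power_iff)

text \<open>The Hadamard inequality for one factor: weights are multiplicative over the index set,
  and the ultrametric inequality makes the constant 1.\<close>

lemma wnorm_wdg_less:
  fixes w :: "('n::finite option, 'k::{field,finite} fls) mvec"
  assumes "wnorm t y w \<le> 1" "\<And>i. wt1 t i * fabs (v i + v None * ext0 y i) < \<epsilon>" "0 < \<epsilon>"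
  shows "wnorm t y (wdg v w) < \<epsilon>"
  unfolding wnorm_less_iff
proof
  fix S :: "'n option set"
  let ?u = "\<lambda>i. v i + v None * ext0 y i"
  have eq: "transv_at y (wdg v w) S = wdg ?u (transv_at y w) S"
    by (simp add: transv_wdg)
  have "fabs (wdg ?u (transv_at y w) S) < \<epsilon> / wt t S"
    unfolding wdg_def
  proof (rule fabs_sum_less)
    fix i assume i: "i \<in> S"
    let ?z = "fabs (transv_at y w (S - {i}))"
    have z: "wt t (S - {i}) * ?z \<le> 1" using assms(1) unfolding wnorm_le_iff by blast
    have "(wt1 t i * fabs (?u i)) * (wt t (S - {i}) * ?z) \<le> (wt1 t i * fabs (?u i)) * 1"
      by (intro mult_left_mono z) (simp add: wt1_pos less_imp_le)
    also have "\<dots> < \<epsilon>" using assms(2) by simp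
    finally have "wt t S * (fabs (?u i) * ?z) < \<epsilon>" by (simp add: wt_remove[OF i] ac_simps)
    then show "fabs (sg i S * ?u i * transv_at y w (S - {i})) < \<epsilon> / wt t S"
      by (simp add: fabs_mult pos_less_divide_eq wt_pos mult.commute)
  qed (rule divide_pos_pos[OF assms(3) wt_pos])
  then show "wt t S * fabs (transv_at y (wdg v w) S) < \<epsilon>"
    unfolding eq by (simp add: pos_less_divide_eq wt_pos mult.commute)
qed

text \<open>
  The minimal integral multiples of integral decomposable multivectors represent the rational
  subspaces of \<open>F\<^sup>n\<^sup>+\<^sup>1\<close>; the first component is the dimension. Subspaces are compared through
  their annihilators \<^const>\<open>ann\<close>, which recover the subspace.
\<close>

definition rational_subspaces :: "(nat \<times> ('n::finite option, 'k::{field,finite} fls) mvec) set" where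
  "rational_subspaces = {(j, w). dec j w \<and> w \<noteq> (\<lambda>_. 0) \<and> range w \<subseteq> intg \<and>
     (\<forall>c. c \<noteq> 0 \<longrightarrow> range (\<lambda>S. c * w S) \<subseteq> intg \<longrightarrow> 1 \<le> fabs c)}"

definition comparable ::
  "nat \<times> ('n::finite option, 'k::{field,finite} fls) mvec \<Rightarrow> nat \<times> ('n option, 'k fls) mvec \<Rightarrow> bool" where
  "comparable p q \<longleftrightarrow> ann (snd p) \<subseteq> ann (snd q) \<or> ann (snd q) \<subseteq> ann (snd p)"

lemma countable_rational_subspaces:
  "countable (rational_subspaces :: (nat \<times> ('n::finite option, 'k::{field,finite} fls) mvec) set)"
proof -
  have "countable (PiE UNIV (\<lambda>_ :: 'n option set. intg :: 'k fls set))"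
    by (intro countable_PiE) (auto intro: countable_intg)
  then have "countable ((UNIV :: nat set) \<times> PiE UNIV (\<lambda>_ :: 'n option set. intg :: 'k fls set))"
    by simp
  then show ?thesis
    by (rule countable_subset[rotated]) (auto simp: rational_subspaces_def)
qed

lemma rational_subspaces_minimal:
  "(j, w) \<in> rational_subspaces \<Longrightarrow> c \<noteq> 0 \<Longrightarrow> range (\<lambda>S. c * w S) \<subseteq> intg \<Longrightarrow> 1 \<le> fabs c"
  by (simp add: rational_subspaces_def)

text \<open>Nested subspaces of equal dimension coincide, so the representatives differ by a scalar;
  minimality of both forces its absolute value to be 1.\<close>

lemma wnorm_eq_if_comparable:
  assumes "p \<in> rational_subspaces" "q \<in> rational_subspaces" "comparable p q" "fst p = fst q"
  shows "wnorm t y (snd p) = wnorm t y (snd q)"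
proof -
  have *: "wnorm t y w = wnorm t y w'"
    if w: "(j, w) \<in> rational_subspaces" "(j, w') \<in> rational_subspaces" "ann w \<subseteq> ann w'" for j w w'
  proof -
    have d: "dec j w" "dec j w'" "w \<noteq> (\<lambda>_. 0)" "w' \<noteq> (\<lambda>_. 0)"
      using w by (auto simp: rational_subspaces_def)
    obtain c where c: "w' = (\<lambda>S. c * w S)"
      using proportional_if_ann_subset[OF d(1,3) _ w(3)] dec_card[OF d(2)] by blast
    have c0: "c \<noteq> 0" using c d(4) by auto
    have "range (\<lambda>S. inverse c * w' S) = range w" "range (\<lambda>S. c * w S) = range w'"
      using c c0 by (simp_all flip: mult.assoc)
    then have "1 \<le> fabs (inverse c)" "1 \<le> fabs c"
      using rational_subspaces_minimal[OF w(2), of "inverse c"] rational_subspaces_minimal[OF w(1), of c]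
        w c0 by (auto simp: rational_subspaces_def)
    then have "fabs c = 1"
      using c0 by (simp add: fabs_inverse one_le_inverse_iff)
    then show ?thesis by (simp add: c wnorm_scale)
  qed
  obtain j w w' where "p = (j, w)" "q = (j, w')" using assms(4) by (cases p; cases q) auto
  then show ?thesis
    using assms(1-3) *[of j w w'] *[of j w' w] by (auto simp: comparable_def)
qed

text \<open>Scaling acts on all coordinates alike, so one nonzero coordinate \<open>S0\<close>
  measures it. On integral multiples its absolute value is e^n with n natural, hence a minimum is
  attained.\<close>

lemma rational_subspace_representative:
  fixes w :: "('n::finite option, 'k::{field,finite} fls) mvec"
  assumes "dec j w" "w \<noteq> (\<lambda>_. 0)" "range w \<subseteq> intg"
  obtains w' c where "(j, w') \<in> rational_subspaces" "w = (\<lambda>S. c * w' S)" "1 \<le> fabs c"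
proof -
  obtain S0 where S0: "w S0 \<noteq> 0" using assms(2) by auto
  define D where "D c n \<longleftrightarrow> c \<noteq> 0 \<and> range (\<lambda>S. c * w S) \<subseteq> intg \<and> fabs (c * w S0) = exp (real n)" for c and n :: nat
  have ex: "\<exists>n. D c n" if c: "c \<noteq> 0" "range (\<lambda>S. c * w S) \<subseteq> intg" for c
  proof -
    obtain p where p: "c * w S0 = of_poly p" using c(2) by (auto simp: intg_def)
    then have "p \<noteq> 0" using c(1) S0 by (metis mult_eq_0_iff of_poly_0)
    then show ?thesis using c p fabs_of_poly unfolding D_def by metis
  qed
  define n where "n = (LEAST n. \<exists>c. D c n)"
  have "\<exists>n. \<exists>c. D c n" using ex[of 1] assms(3) by auto
  then have "\<exists>c. D c n" unfolding n_def by (rule LeastI_ex)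
  then obtain c where c: "D c n" by blast
  have min: "fabs c \<le> fabs c'" if c': "c' \<noteq> 0" "range (\<lambda>S. c' * w S) \<subseteq> intg" for c'
  proof -
    obtain m where m: "D c' m" using ex[OF c'] by blast
    then have "n \<le> m" unfolding n_def by (intro Least_le) blast
    then have "fabs (c * w S0) \<le> fabs (c' * w S0)" using c m by (simp add: D_def)
    then show ?thesis using S0 by (simp add: fabs_mult)
  qed
  have c0: "c \<noteq> 0" using c by (simp add: D_def)
  have "(j, \<lambda>S. c * w S) \<in> rational_subspaces"
    unfolding rational_subspaces_def
  proof (intro CollectI case_prodI conjI allI impI)
    show "dec j (\<lambda>S. c * w S)" by (rule dec_scale[OF assms(1)])
    show "(\<lambda>S. c * w S) \<noteq> (\<lambda>_. 0)" using c0 S0 by (metis mult_eq_0_iff)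
    show "range (\<lambda>S. c * w S) \<subseteq> intg" using c by (simp add: D_def)
    fix c' assume "c' \<noteq> 0" "range (\<lambda>S. c' * (c * w S)) \<subseteq> intg"
    then have "fabs c \<le> fabs (c' * c)" using min[of "c' * c"] c0 by (simp add: mult.assoc)
    then show "1 \<le> fabs c'" using c0 by (simp add: fabs_mult)
  qed
  moreover have "w = (\<lambda>S. inverse c * (c * w S))" using c0 by (simp add: fun_eq_iff)
  moreover have "1 \<le> fabs (inverse c)"
    using min[of 1] assms(3) c0 by (simp add: fabs_inverse one_le_inverse_iff)
  ultimately show ?thesis by (rule that)
qed

section \<open>Short vectors and flags\<close>

definition unit_mvec :: "('i::finite, 'a::comm_ring_1) mvec" where
  "unit_mvec S = (if S = {} then 1 else 0)"

lemma ann_unit_mvec: "ann (unit_mvec :: ('i::finite, 'a::comm_ring_1) mvec) = {\<lambda>_. 0}"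
proof -
  have "v = (\<lambda>_. 0)" if v: "v \<in> ann unit_mvec" for v :: "'i \<Rightarrow> 'a"
  proof
    fix i
    have "wdg v unit_mvec {i} = sg i {i} * v i" by (simp add: wdg_def unit_mvec_def)
    then have "sg i {i} * (sg i {i} * v i) = 0" using v by (simp add: ann_def)
    then show "v i = 0" by (simp flip: mult.assoc)
  qed
  then show ?thesis by (auto simp: ann_def wdg_linear)
qed

lemma unit_mvec_rational:
  "(0, unit_mvec :: ('n::finite option, 'k::{field,finite} fls) mvec) \<in> rational_subspaces"
proof -
  have "dec 0 (unit_mvec :: ('n option, 'k fls) mvec)"
    using dec.dec_0[of 1] unfolding unit_mvec_def[abs_def] .
  moreover have "1 \<le> fabs c" if "c \<noteq> 0" "range (\<lambda>S. c * (unit_mvec :: ('n option, 'k fls) mvec) S) \<subseteq> intg" for c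
    using that by (intro fabs_intg_ge_1) (auto simp: unit_mvec_def image_subset_iff split: if_splits)
  ultimately show ?thesis
    by (auto simp: rational_subspaces_def unit_mvec_def fun_eq_iff)
qed

lemma wnorm_unit_mvec: "wnorm t y unit_mvec = 1"
proof -
  have "contr e0 unit_mvec = (\<lambda>_. 0)" by (simp add: fun_eq_iff contr_e0 unit_mvec_def)
  then have "transv_at y unit_mvec S = unit_mvec S" for S
    unfolding transv_def \<open>contr e0 unit_mvec = (\<lambda>_. 0)\<close> by (simp add: wdg_linear)
  then have le: "wnorm t y unit_mvec \<le> 1" and "\<not> wnorm t y unit_mvec < 1"
    unfolding wnorm_le_iff wnorm_less_iff by (auto simp: unit_mvec_def)
  then show ?thesis by simp
qed

text \<open>Let w be the largest flag member not containing v. Adjoining v gives a rational subspace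
  comparable with the whole flag, so marking makes its norm at least \<epsilon>; but w has norm at
  most 1 and v is shorter than \<epsilon>, so the norm is less than \<epsilon>.\<close>

lemma no_short_vector_if_marked:
  fixes v :: "'n::finite option \<Rightarrow> 'k::{field,finite} fls" and y :: "'x \<Rightarrow> ('k fls) ^ 'n"
  assumes marked: "marked comparable (\<lambda>p x. wnorm t (y x) (snd p)) \<epsilon> \<rho> rational_subspaces x"
    and "\<rho> \<le> 1" "0 < \<epsilon>" "v \<noteq> (\<lambda>_. 0)" "range v \<subseteq> intg"
    and short: "\<And>i. wt1 t i * fabs (v i + v None * ext0 (y x) i) < \<epsilon>"
  shows False
proof -
  let ?\<psi> = "\<lambda>p. wnorm t (y x) (snd p)"
  obtain F where F: "F \<subseteq> rational_subspaces" "finite F" "\<And>p q. p \<in> F \<Longrightarrow> q \<in> F \<Longrightarrow> comparable p q"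
    "\<And>p. p \<in> F \<Longrightarrow> ?\<psi> p < \<rho>"
    "\<And>p. p \<in> rational_subspaces \<Longrightarrow> (\<And>q. q \<in> F \<Longrightarrow> comparable p q) \<Longrightarrow> \<epsilon> \<le> ?\<psi> p"
    using marked unfolding marked_def by metis
  \<comment> \<open>The zero subspace has norm 1 and is comparable with everything; adding it to the
    flag ensures that some member does not contain v.\<close>
  define G where "G = {q \<in> insert (0, unit_mvec) F. v \<notin> ann (snd q)}"
  have "(0, unit_mvec) \<in> G" using assms(4) by (simp add: G_def ann_unit_mvec)
  then have "finite ((ann \<circ> snd) ` G)" "(ann \<circ> snd) ` G \<noteq> {}" using F(2) by (auto simp: G_def)
  from finite_has_maximal[OF this] obtain A
    where A: "A \<in> (ann \<circ> snd) ` G" "\<And>B. B \<in> (ann \<circ> snd) ` G \<Longrightarrow> A \<subseteq> B \<Longrightarrow> A = B"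
    by blast
  obtain q where "q \<in> G" "A = ann (snd q)" using A(1) by auto
  then have q: "q \<in> G" "\<And>q'. q' \<in> G \<Longrightarrow> ann (snd q) \<subseteq> ann (snd q') \<Longrightarrow> ann (snd q) = ann (snd q')"
    using A(2) by auto
  obtain j w where jw: "q = (j, w)" by (cases q)
  have zero_in_ann: "(\<lambda>_. 0) \<in> ann w'" for w' :: "('n option, 'k fls) mvec"
    by (simp add: ann_def wdg_linear)
  have cmp: "comparable p q'" if "p \<in> insert (0, unit_mvec) F" "q' \<in> insert (0, unit_mvec) F" for p q'
  proof (cases "p \<in> F \<and> q' \<in> F")
    case False
    then have "p = (0, unit_mvec) \<or> q' = (0, unit_mvec)" using that by blast
    then show ?thesis using zero_in_ann by (auto simp: comparable_def ann_unit_mvec)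
  qed (use F(3) in blast)
  have "q \<in> rational_subspaces" "?\<psi> q \<le> 1" "v \<notin> ann w"
    using q(1) F(1) F(4)[of q] assms(2) unit_mvec_rational
    by (auto simp: G_def wnorm_unit_mvec jw)
  then have w: "dec j w" "range w \<subseteq> intg" "v \<notin> ann w" "wnorm t (y x) w \<le> 1"
    by (auto simp: rational_subspaces_def jw)
  have "dec (Suc j) (wdg v w)" using w(1) by (rule dec_Suc)
  moreover have "wdg v w \<noteq> (\<lambda>_. 0)" using w(3) by (auto simp: ann_def fun_eq_iff)
  moreover have "range (wdg v w) \<subseteq> intg"
  proof -
    have "sg i S \<in> intg" for i :: "'n option" and S
      by (simp add: sg_def minus_one_power_iff intg_minus)
    then have "wdg v w S \<in> intg" for S
      unfolding wdg_def using assms(5) w(2) by (intro intg_sum intg_mult) auto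
    then show ?thesis by auto
  qed
  ultimately obtain w' c where w': "(Suc j, w') \<in> rational_subspaces" "wdg v w = (\<lambda>S. c * w' S)" "1 \<le> fabs c"
    by (rule rational_subspace_representative)
  have c0: "c \<noteq> 0" using w'(3) by auto
  have ann_w': "ann w' = ann (wdg v w)" unfolding w'(2) by (rule ann_scale[OF c0, symmetric])
  have "\<epsilon> \<le> wnorm t (y x) w'"
  proof -
    \<comment> \<open>A flag member containing v cannot lie in w, so it contains w and hence the
      span of both. One not containing v lies in w by maximality.\<close>
    have "comparable (Suc j, w') q'" if q': "q' \<in> F" for q'
    proof (cases "v \<in> ann (snd q')")
      case True
      have "comparable q q'" using cmp q(1) q' by (auto simp: G_def)
      then have "ann w \<subseteq> ann (snd q')" using True w(3) by (auto simp: comparable_def jw)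
      then have "ann (wdg v w) \<subseteq> ann (snd q')"
        by (rule ann_wdg_subset[OF w(1,3) fun_subspace_ann _ True])
      then show ?thesis by (simp add: comparable_def ann_w')
    next
      case False
      then have "q' \<in> G" using q' by (simp add: G_def)
      moreover have "comparable q q'" using cmp q(1) q' by (auto simp: G_def)
      ultimately have "ann (snd q') \<subseteq> ann w"
        using q(2)[of q'] by (auto simp: comparable_def jw)
      then show ?thesis using ann_subset_ann_wdg[of w v] by (auto simp: comparable_def ann_w')
    qed
    then show ?thesis using F(5)[OF w'(1)] by simp
  qed
  \<comment> \<open>The product is an integral multiple c of the minimal representative with |c| at
    least 1, so the representative is no larger than the product.\<close>
  also have "\<dots> \<le> fabs c * wnorm t (y x) w'"
  proof -
    have "0 \<le> wnorm t (y x) w'" using \<open>\<epsilon> \<le> wnorm t (y x) w'\<close> assms(3) by linarith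
    then show ?thesis using mult_right_mono[OF w'(3)] by simp
  qed
  also have "\<dots> = wnorm t (y x) (wdg v w)" unfolding w'(2) wnorm_scale ..
  also have "\<dots> < \<epsilon>" using wnorm_wdg_less[OF w(4) short assms(3)] .
  finally show False by simp
qed

section \<open>The exponent\<close>

lemma transv_at_eq_affine_comb: "transv_at (f z) w S = affine_comb (w S) (transv_coeff w S) f z"
  by (simp add: transv_at_eq affine_comb_def)

text \<open>The vectors e at which every linear form is bounded by a fixed multiple of its bound on
  the points (1, f(z)) form a subspace. It contains all these points, so by independence it is
  everything; at the unit vectors it bounds each coefficient. No compactness or continuity
  enters.\<close>

lemma affine_comb_lower_bound:
  fixes f :: "'x \<Rightarrow> ('k::{field,finite} fls) ^ 'n"
  assumes indep: "\<And>c0 c. (\<forall>z\<in>B. affine_comb c0 c f z = 0) \<Longrightarrow> c0 = 0 \<and> c = 0"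
  obtains \<rho> where "0 < \<rho>" "\<rho> \<le> 1"
    "\<And>c0 c. 1 \<le> fabs c0 \<or> (\<exists>i. 1 \<le> fabs (vec_nth c i)) \<Longrightarrow> \<exists>z\<in>B. \<rho> \<le> fabs (affine_comb c0 c f z)"
proof -
  define F where "F z = case_option 1 (vec_nth (f z))" for z
  \<comment> \<open>M ranges over all upper bounds on B, which avoids a supremum that may be
    infinite.\<close>
  define bound where "bound e K \<longleftrightarrow> 0 \<le> K \<and> (\<forall>c M. 0 \<le> M \<longrightarrow>
    (\<forall>z\<in>B. fabs (pair c (F z)) \<le> M) \<longrightarrow> fabs (pair c e) \<le> K * M)" for e and K :: real
  have boundD: "fabs (pair c e) \<le> K * M"
    if "bound e K" "0 \<le> M" "\<forall>z\<in>B. fabs (pair c (F z)) \<le> M" for e K c M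
    using that unfolding bound_def by blast
  define E where "E = {e. \<exists>K. bound e K}"
  have pair_F: "pair c (F z) = affine_comb (c None) (\<chi> i. c (Some i)) f z" for c z
    by (simp add: pair_def sum_UNIV_option F_def affine_comb_def)
  have pair_linear: "pair c (\<lambda>_. 0) = 0" "pair c (\<lambda>i. a i + b i) = pair c a + pair c b"
    "pair c (\<lambda>i. r * a i) = r * pair c a" for c a b :: "'n option \<Rightarrow> 'k fls" and r
    by (simp_all add: pair_def sum.distrib sum_distrib_left algebra_simps)
  have fabs_add: "fabs (a + b) \<le> fabs a + fabs b" for a b :: "'k fls"
  proof (rule ccontr)
    assume *: "\<not> ?thesis"
    then have "fabs a < fabs (a + b)" "fabs b < fabs (a + b)"
      using fabs_ge_0[of a] fabs_ge_0[of b] by linarith+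
    then show False using fabs_add_less by blast
  qed
  have E_add: "(\<lambda>i. a i + b i) \<in> E" if ab: "a \<in> E" "b \<in> E" for a b
  proof -
    obtain K K' where K: "bound a K" "bound b K'" using ab by (auto simp: E_def)
    have "fabs (pair c (\<lambda>i. a i + b i)) \<le> (K + K') * M"
      if M: "0 \<le> M" "\<forall>z\<in>B. fabs (pair c (F z)) \<le> M" for c M
      using boundD[OF K(1) M] boundD[OF K(2) M] fabs_add[of "pair c a" "pair c b"]
      unfolding pair_linear distrib_right by linarith
    then have "bound (\<lambda>i. a i + b i) (K + K')" using K by (simp add: bound_def)
    then show ?thesis by (auto simp: E_def)
  qed
  have E_scale: "(\<lambda>i. r * a i) \<in> E" if a: "a \<in> E" for r a
  proof -
    obtain K where K: "bound a K" using a by (auto simp: E_def)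
    have "fabs (pair c (\<lambda>i. r * a i)) \<le> (fabs r * K) * M"
      if M: "0 \<le> M" "\<forall>z\<in>B. fabs (pair c (F z)) \<le> M" for c M
      using mult_left_mono[OF boundD[OF K M] fabs_ge_0[of r]]
      unfolding pair_linear fabs_mult mult.assoc .
    then have "bound (\<lambda>i. r * a i) (fabs r * K)" using K by (simp add: bound_def)
    then show ?thesis by (auto simp: E_def)
  qed
  have "bound (\<lambda>_. 0) 0" by (simp add: bound_def pair_linear)
  then have "(\<lambda>_. 0) \<in> E" by (auto simp: E_def)
  then have sub: "fun_subspace E" unfolding fun_subspace_def using E_add E_scale by simp
  have F_E: "F z \<in> E" if "z \<in> B" for z
  proof -
    have "bound (F z) 1" using that by (simp add: bound_def)
    then show ?thesis by (auto simp: E_def)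
  qed
  have all_E: "u \<in> E" for u
  proof (rule ccontr)
    assume "u \<notin> E"
    then obtain c where c: "\<And>v. v \<in> E \<Longrightarrow> pair c v = 0" "pair c u = 1"
      using separating_functional[OF sub] by blast
    then have "c None = 0 \<and> (\<chi> i. c (Some i)) = 0"
      using F_E by (intro indep) (simp flip: pair_F)
    then have "c i = 0" for i by (cases i) (auto simp: vec_eq_iff)
    then show False using c(2) by (simp add: pair_def)
  qed
  have "\<exists>K. bound (\<lambda>j. if j = i then 1 else 0) K" for i
    using all_E[of "\<lambda>j. if j = i then 1 else 0"] by (simp add: E_def)
  then obtain K where K: "\<And>i. bound (\<lambda>j. if j = i then 1 else 0) (K i)" by metis
  have K0: "0 \<le> K i" for i using K[of i] by (simp add: bound_def)
  have pair_unit: "pair c (\<lambda>j. if j = i then 1 else 0) = c i" for c :: "'n option \<Rightarrow> 'k fls" and i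
  proof -
    have "pair c (\<lambda>j. if j = i then 1 else 0) = (\<Sum>j\<in>UNIV. if j = i then c j else 0)"
      unfolding pair_def by (intro sum.cong) auto
    then show ?thesis by simp
  qed
  \<comment> \<open>The summand 1 makes s strictly larger than each \<open>K i\<close>, so that a
    form below 1 / s on B has all coefficients below 1.\<close>
  define s where "s = 1 + (\<Sum>i\<in>UNIV. K i)"
  have s1: "1 \<le> s" using sum_nonneg[of UNIV K] K0 by (simp add: s_def)
  have s2: "K i < s" for i
    using member_le_sum[of i UNIV K] K0 by (simp add: s_def)
  show ?thesis
  proof (rule that[of "1 / s"])
    show "0 < 1 / s" "1 / s \<le> 1" using s1 by auto
    fix c0 :: "'k fls" and c :: "('k fls) ^ 'n"
    assume c: "1 \<le> fabs c0 \<or> (\<exists>i. 1 \<le> fabs (vec_nth c i))"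
    define c' where "c' = case_option c0 (vec_nth c)"
    have c'_F: "pair c' (F z) = affine_comb c0 c f z" for z
      unfolding pair_F by (simp add: c'_def)
    have "\<exists>i. 1 \<le> fabs (c' i)"
      using c
    proof (elim disjE exE)
      show ?thesis if "1 \<le> fabs c0" using that by (intro exI[of _ None]) (simp add: c'_def)
      show ?thesis if "1 \<le> fabs (vec_nth c i)" for i using that by (intro exI[of _ "Some i"]) (simp add: c'_def)
    qed
    then obtain i where i: "1 \<le> fabs (c' i)" by blast
    show "\<exists>z\<in>B. 1 / s \<le> fabs (affine_comb c0 c f z)"
    proof (rule ccontr)
      assume "\<not> ?thesis"
      then have "\<forall>z\<in>B. fabs (pair c' (F z)) \<le> 1 / s" by (auto simp: c'_F)
      then have "fabs (c' i) \<le> K i * (1 / s)"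
        using boundD[OF K[of i], of "1 / s" c'] s1 by (simp add: pair_unit)
      also have "\<dots> < 1" using s1 s2[of i] by simp
      finally show False using i by simp
    qed
  qed
qed

text \<open>Each nonzero integral w has a coordinate of weight at least 1 that is an affine
  combination with a coefficient of absolute value at least 1. Hence one \<rho> serves for all w and
  t.\<close>

lemma wnorm_lower_bound:
  fixes f :: "'x \<Rightarrow> ('k::{field,finite} fls) ^ 'n"
  assumes \<rho>: "\<rho> \<le> 1" "B \<noteq> {}"
    "\<And>c0 c. 1 \<le> fabs c0 \<or> (\<exists>i. 1 \<le> fabs (vec_nth c i)) \<Longrightarrow> \<exists>z\<in>B. \<rho> \<le> fabs (affine_comb c0 c f z)"
    and w: "range w \<subseteq> intg" "w \<noteq> (\<lambda>_. 0)" and t: "0 \<le> t"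
  shows "\<exists>z\<in>B. \<rho> \<le> wnorm t (f z) w"
proof -
  have ge_1: "1 \<le> fabs (w S)" if "w S \<noteq> 0" for S
    using w(1) that by (intro fabs_intg_ge_1) auto
  have le_wnorm: "wt t S * fabs (transv_at y w S) \<le> wnorm t y w" for S y
    unfolding wnorm_def by (intro Max_ge) auto
  have coeff: "\<exists>z\<in>B. \<rho> \<le> wnorm t (f z) w"
    if S: "None \<notin> S" "1 \<le> fabs (w S) \<or> (\<exists>i. 1 \<le> fabs (vec_nth (transv_coeff w S) i))" for S
  proof -
    obtain z where z: "z \<in> B" "\<rho> \<le> fabs (transv_at (f z) w S)"
      using \<rho>(3)[OF S(2)] unfolding transv_at_eq_affine_comb by blast
    have "1 * fabs (transv_at (f z) w S) \<le> wt t S * fabs (transv_at (f z) w S)"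
      by (intro mult_right_mono wt_ge_1 S(1) t) auto
    then show ?thesis using z le_wnorm[of S "f z"] by (intro bexI[of _ z]) auto
  qed
  obtain S where S: "w S \<noteq> 0" using w(2) by auto
  consider "None \<notin> S" | i where "None \<in> S" "Some i \<notin> S" | "S = UNIV"
    by (metis UNIV_eq_I not_Some_eq)
  then show ?thesis
  proof cases
    case 1
    then show ?thesis using coeff[of S] ge_1[OF S] by blast
  next
    case 2
    \<comment> \<open>Exchanging \<open>None\<close> for \<open>Some i\<close> gives a coordinate of
      weight at least 1 in which y at i has coefficient w S up to sign.\<close>
    define T where "T = insert (Some i) (S - {None})"
    have "T - {Some i} = S - {None}" "insert None (S - {None}) = S"
      using 2 by (auto simp: T_def)
    then have "vec_nth (transv_coeff w T) i = sg (Some i) T * (sg None (S - {None}) * w S)"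
      by (simp add: transv_coeff_def contr_e0) (simp add: T_def)
    then have "1 \<le> fabs (vec_nth (transv_coeff w T) i)"
      using ge_1[OF S] by (simp add: fabs_mult)
    then show ?thesis using coeff[of T] by (auto simp: T_def)
  next
    case 3
    obtain z where z: "z \<in> B" using \<rho>(2) by blast
    \<comment> \<open>In top degree the unipotent map and the flow act by their determinant, which
      is 1.\<close>
    have "transv_coeff w UNIV = 0"
      by (simp add: transv_coeff_def vec_eq_iff contr_e0)
    then have "transv_at (f z) w UNIV = w UNIV" by (simp add: transv_at_eq)
    then have "\<rho> \<le> wt t UNIV * fabs (transv_at (f z) w UNIV)"
      using \<rho>(1) ge_1[OF S] 3 by (simp add: wt_UNIV)
    then show ?thesis using z le_wnorm[of UNIV "f z"] by (meson order_trans)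
  qed
qed

text \<open>Transference is applied at t = m^2 + m with M = n m^2 - m. As n t - M = (n + 1) m is of
  smaller order than t, every \<omega> < 1 is admissible, and 1 is their supremum.\<close>

lemma inhom_exponent_ge_1:
  fixes y :: "('k::{field,finite} fls) ^ 'n"
  assumes "\<exists>\<^sub>F m :: nat in sequentially. \<forall>(a :: 'k poly) (b :: 'n \<Rightarrow> 'k poly). a \<noteq> 0 \<longrightarrow>
      fabs (of_poly a) < exp (real CARD('n) * (real m)\<^sup>2 - real m) \<longrightarrow>
      \<not> (\<forall>i. fabs (of_poly a * vec_nth y i + of_poly (b i)) < exp (- ((real m)\<^sup>2 + real m)))"
  shows "1 \<le> inhom_exponent y \<theta>"
proof -
  have "ereal \<omega> \<le> inhom_exponent y \<theta>" if \<omega>: "\<omega> < 1" for \<omega> :: real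
    unfolding inhom_exponent_def
  proof (intro Sup_upper CollectI exI[of _ \<omega>] conjI refl)
    let ?n = "real CARD('n)"
    have n: "1 \<le> ?n" by (simp add: Suc_leI)
    have "0 < ?n * (1 - \<omega>)" using n \<omega> by simp
    \<comment> \<open>The inequality finally needed is n \<omega> m + m + 1 \<le> n (1 - \<omega>)
      m^2; the 2 comes from m + 1 \<le> 2 m, and one factor m has been divided out.\<close>
    obtain m0 :: nat where "(2 + ?n * \<bar>\<omega>\<bar>) / (?n * (1 - \<omega>)) < real m0" using reals_Archimedean2 by blast
    then have m0: "2 + ?n * \<bar>\<omega>\<bar> < ?n * (1 - \<omega>) * real m0"
      using \<open>0 < ?n * (1 - \<omega>)\<close> by (simp add: pos_divide_less_eq mult.commute)
    show "\<exists>\<^sub>F t :: nat in sequentially. \<exists>(p0 :: 'k poly) (q :: 'k poly ^ 'n). q \<noteq> 0 \<and>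
         fabs (dotp y (of_poly_vec q) - of_poly p0 - \<theta>) < exp (- (?n * \<omega> * real t)) \<and>
         supnorm (of_poly_vec q) < exp (real t)"
      unfolding frequently_sequentially
    proof
      fix t0
      obtain m where m: "max 2 (max m0 t0) \<le> m" "\<And>(a :: 'k poly) (b :: 'n \<Rightarrow> 'k poly). a \<noteq> 0 \<Longrightarrow>
          fabs (of_poly a) < exp (?n * (real m)\<^sup>2 - real m) \<Longrightarrow>
          (\<And>i. fabs (of_poly a * vec_nth y i + of_poly (b i)) < exp (- ((real m)\<^sup>2 + real m))) \<Longrightarrow> False"
        using assms unfolding frequently_sequentially by meson
      \<comment> \<open>The bound m \<ge> 2 gives 2 m \<le> m^2, so the natural subtraction is a
        true one and M is at least m.\<close>
      define t M where "t = m\<^sup>2 + m" and "M = CARD('n) * m\<^sup>2 - m"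
      have "1 * m\<^sup>2 \<le> CARD('n) * m\<^sup>2" by (rule mult_le_mono1) (simp add: Suc_leI)
      moreover have "2 * m \<le> m\<^sup>2" using m(1) by (simp add: power2_eq_square)
      ultimately have M: "m + m \<le> CARD('n) * m\<^sup>2" by linarith
      then have M_real: "real M = ?n * (real m)\<^sup>2 - real m" and M1: "1 \<le> M"
        using m(1) unfolding M_def by (auto simp: of_nat_diff)
      have t_real: "real t = (real m)\<^sup>2 + real m" by (simp add: t_def)
      obtain p q where pq: "q \<noteq> 0" "supnorm (of_poly_vec q) < exp (real t)"
        "fabs (dotp y (of_poly_vec q) - of_poly p - \<theta>) < exp (- (real M - 1))"
      proof (rule exists_inhomogeneous_solution[of M y t \<theta>])
        show False if "a \<noteq> 0" "fabs (of_poly a) < exp (real M)"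
          "\<And>i. fabs (of_poly a * vec_nth y i + of_poly (b i)) < exp (- real t)"
          for a :: "'k poly" and b :: "'n \<Rightarrow> 'k poly"
          by (rule m(2)[OF that(1)]) (use that in \<open>simp_all add: M_real t_real\<close>)
      qed (use M1 that in auto)
      have "?n * \<omega> * real t \<le> real M - 1"
      proof -
        have "?n * (1 - \<omega>) * real m0 \<le> ?n * (1 - \<omega>) * real m"
          using m(1) \<open>0 < ?n * (1 - \<omega>)\<close> by (intro mult_left_mono) auto
        then have "2 + ?n * \<bar>\<omega>\<bar> \<le> ?n * (1 - \<omega>) * real m" using m0 by linarith
        moreover have "?n * \<omega> \<le> ?n * \<bar>\<omega>\<bar>" by (intro mult_left_mono) auto
        ultimately have "2 + ?n * \<omega> \<le> ?n * (1 - \<omega>) * real m" by (meson add_left_mono order_trans)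
        then have "(2 + ?n * \<omega>) * real m \<le> (?n * (1 - \<omega>) * real m) * real m"
          by (rule mult_right_mono) simp
        then show ?thesis
          using m(1) by (simp add: M_real t_real power2_eq_square algebra_simps)
      qed
      then have "exp (- (real M - 1)) \<le> exp (- (?n * \<omega> * real t))" by simp
      moreover have "t0 \<le> t" using m(1) by (simp add: t_def)
      ultimately show "\<exists>t\<ge>t0. \<exists>(p0 :: 'k poly) (q :: 'k poly ^ 'n). q \<noteq> 0 \<and>
         fabs (dotp y (of_poly_vec q) - of_poly p0 - \<theta>) < exp (- (?n * \<omega> * real t)) \<and>
         supnorm (of_poly_vec q) < exp (real t)"
        using pq by (meson less_le_trans)
    qed
  qed
  then have *: "\<And>\<omega> :: real. \<omega> < 1 \<Longrightarrow> ereal \<omega> \<le> inhom_exponent y \<theta>" .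
  show ?thesis
  proof (rule ccontr)
    assume "\<not> ?thesis"
    then have "inhom_exponent y \<theta> < 1" by simp
    then obtain \<omega> where "inhom_exponent y \<theta> < ereal \<omega>" "ereal \<omega> < 1"
      using ereal_dense2 by blast
    then show False using *[of \<omega>] by simp
  qed
qed

section \<open>From goodness to measure estimates\<close>

context haar_measure
begin

text \<open>The supremum is replaced by a lower bound for one value, in the form in which
  \<open>nondivergence\<close> uses goodness. Goodness speaks of the completed measure, whose value
  dominates the outer measure.\<close>

lemma good_fun_outer_measure:
  assumes good: "good_fun \<mu> C \<alpha> U g" and "0 < C" "0 < \<alpha>" "open U" "Bl l y \<subseteq> U"
    and z: "z \<in> Bl l y" "\<delta> \<le> fabs (g z)" and "0 < \<delta>" "0 < \<epsilon>"
  shows "outer_measure_of \<mu> {x \<in> Bl l y. fabs (g x) < \<epsilon>} \<le> ennreal (C * (\<epsilon> / \<delta>) powr \<alpha>) * emeasure \<mu> (Bl l y)"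
proof -
  define s where "s = (SUP x\<in>Bl l y. ennreal (fabs (g x)))"
  have "ennreal \<delta> \<le> ennreal (fabs (g z))" using z(2) by (rule ennreal_leI)
  also have "\<dots> \<le> s" unfolding s_def using z(1) by (rule SUP_upper)
  finally have s: "ennreal \<delta> \<le> s" .
  then have s0: "s \<noteq> 0" using \<open>0 < \<delta>\<close> by (auto simp: ennreal_eq_0_iff)
  have meas: "(\<lambda>x. fabs (g x)) \<in> borel_measurable (restrict_space (completion \<mu>) U)"
    using good by (simp add: good_fun_def)
  have U: "U \<in> sets (completion \<mu>)" using \<open>open U\<close> open_in_sets by (simp add: sets_completionI_sets)
  have "{x \<in> space (restrict_space (completion \<mu>) U). fabs (g x) < \<epsilon>} \<in> sets (restrict_space (completion \<mu>) U)"
    using meas by measurable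
  then have "{x \<in> U. fabs (g x) < \<epsilon>} \<in> sets (completion \<mu>)"
    using U by (simp add: space_restrict_space sets_restrict_space_iff space_haar)
  then have "{x \<in> U. fabs (g x) < \<epsilon>} \<inter> Bl l y \<in> sets (completion \<mu>)"
    by (rule sets.Int) (rule sets_completionI_sets[OF Bl_in_sets])
  also have "{x \<in> U. fabs (g x) < \<epsilon>} \<inter> Bl l y = {x \<in> Bl l y. fabs (g x) < \<epsilon>}"
    using \<open>Bl l y \<subseteq> U\<close> by auto
  finally have "outer_measure_of \<mu> {x \<in> Bl l y. fabs (g x) < \<epsilon>} \<le> emeasure (completion \<mu>) {x \<in> Bl l y. fabs (g x) < \<epsilon>}"
    by (rule outer_measure_of_le_completion)
  also have "\<dots> \<le> ennreal (C * enn2real (ennreal \<epsilon> / s) powr \<alpha>) * emeasure \<mu> (Bl l y)"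
  proof -
    have "\<forall>x0 r \<epsilon>. r > 0 \<and> supball x0 r \<subseteq> U \<and> \<epsilon> > 0 \<longrightarrow>
        (SUP x\<in>supball x0 r. ennreal (fabs (g x))) \<noteq> 0 \<longrightarrow>
          emeasure (completion \<mu>) {x\<in>supball x0 r. fabs (g x) < \<epsilon>}
            \<le> ennreal (C * enn2real (ennreal \<epsilon> / (SUP x\<in>supball x0 r. ennreal (fabs (g x)))) powr \<alpha>) * emeasure \<mu> (supball x0 r)"
      using good by (simp add: good_fun_def Let_def)
    from this[rule_format, of "exp (- real_of_int l)" y \<epsilon>] show ?thesis
      using s0 \<open>Bl l y \<subseteq> U\<close> \<open>0 < \<epsilon>\<close> unfolding s_def Bl_eq_supball by simp
  qed
  also have "\<dots> \<le> ennreal (C * (\<epsilon> / \<delta>) powr \<alpha>) * emeasure \<mu> (Bl l y)"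
  proof -
    have "enn2real (ennreal \<epsilon> / s) \<le> \<epsilon> / \<delta>"
    proof (cases s)
      case (real r)
      then have "\<delta> \<le> r" using s by simp
      then have "ennreal \<epsilon> / s = ennreal (\<epsilon> / r)" "\<epsilon> / r \<le> \<epsilon> / \<delta>"
        using \<open>0 < \<delta>\<close> \<open>0 < \<epsilon>\<close> real by (auto simp: divide_ennreal intro!: divide_left_mono)
      then show ?thesis using \<open>0 < \<delta>\<close> \<open>\<delta> \<le> r\<close> \<open>0 < \<epsilon>\<close> by simp
    next
      \<comment> \<open>For an infinite supremum the quotient is 0, below any bound.\<close>
      case top
      then show ?thesis using \<open>0 < \<delta>\<close> \<open>0 < \<epsilon>\<close> by simp
    qed
    then have "enn2real (ennreal \<epsilon> / s) powr \<alpha> \<le> (\<epsilon> / \<delta>) powr \<alpha>"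
      using \<open>0 < \<alpha>\<close> by (intro powr_mono2) auto
    then show ?thesis using \<open>0 < C\<close> by (intro mult_right_mono ennreal_leI mult_left_mono) auto
  qed
  finally show ?thesis .
qed

text \<open>A maximum of good functions is good: one coordinate reaches \<rho> at z, and its
  sublevel set contains that of the norm. Its weight cancels in the quotient, so the constants do
  not depend on t or w.\<close>

lemma wnorm_good:
  fixes f :: "('k fls) ^ 'd \<Rightarrow> ('k fls) ^ 'n"
  assumes good: "good_map \<mu> C \<alpha> U f" and "0 < C" "0 < \<alpha>" "open U" "Bl l y \<subseteq> U"
    and z: "z \<in> Bl l y" "\<rho> \<le> wnorm t (f z) w" and "0 < \<rho>" "0 < \<epsilon>"
  shows "outer_measure_of \<mu> {x \<in> Bl l y. wnorm t (f x) w < \<epsilon>} \<le> ennreal (C * (\<epsilon> / \<rho>) powr \<alpha>) * emeasure \<mu> (Bl l y)"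
proof -
  let ?g = "\<lambda>S. affine_comb (w S) (transv_coeff w S) f"
  have "\<not> wnorm t (f z) w < \<rho>" using z(2) by simp
  then obtain S where S: "\<rho> \<le> wt t S * fabs (?g S z)"
    unfolding wnorm_less_iff transv_at_eq_affine_comb by (auto simp: not_less)
  have "outer_measure_of \<mu> {x \<in> Bl l y. wnorm t (f x) w < \<epsilon>} \<le> outer_measure_of \<mu> {x \<in> Bl l y. fabs (?g S x) < \<epsilon> / wt t S}"
    unfolding wnorm_less_iff transv_at_eq_affine_comb
    by (intro outer_measure_of_mono) (auto simp: pos_less_divide_eq wt_pos mult.commute)
  also have "\<dots> \<le> ennreal (C * ((\<epsilon> / wt t S) / (\<rho> / wt t S)) powr \<alpha>) * emeasure \<mu> (Bl l y)"
  proof (rule good_fun_outer_measure[OF _ \<open>0 < C\<close> \<open>0 < \<alpha>\<close> \<open>open U\<close> \<open>Bl l y \<subseteq> U\<close> z(1)])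
    show "good_fun \<mu> C \<alpha> U (?g S)" using good by (simp add: good_map_def)
    show "\<rho> / wt t S \<le> fabs (?g S z)" using S by (simp add: pos_divide_le_eq wt_pos mult.commute)
  qed (use wt_pos \<open>0 < \<rho>\<close> \<open>0 < \<epsilon>\<close> in \<open>auto intro: divide_pos_pos\<close>)
  also have "(\<epsilon> / wt t S) / (\<rho> / wt t S) = \<epsilon> / \<rho>" using wt_pos[of t S] by simp
  finally show ?thesis .
qed

lemma exponent_in_ball:
  fixes f :: "('k fls) ^ 'd \<Rightarrow> ('k fls) ^ 'n"
  assumes good: "good_map \<mu> C \<alpha> U f" and C: "0 < C" and \<alpha>: "0 < \<alpha>" and U: "open U" "Bl k x \<subseteq> U"
    and indep: "\<And>c0 c. (\<forall>z\<in>Bl k x. affine_comb c0 c f z = 0) \<Longrightarrow> c0 = 0 \<and> c = 0"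
  shows "outer_measure_of \<mu> {z \<in> Bl k x. \<not> 1 \<le> inhom_exponent (f z) \<theta>} = 0"
proof -
  obtain \<rho> where \<rho>: "0 < \<rho>" "\<rho> \<le> 1"
    "\<And>c0 c. 1 \<le> fabs c0 \<or> (\<exists>i. 1 \<le> fabs (vec_nth c i)) \<Longrightarrow> \<exists>z\<in>Bl k x. \<rho> \<le> fabs (affine_comb c0 c f z)"
    using affine_comb_lower_bound[of "Bl k x" f, OF indep] by blast
  define psi where "psi m p z = wnorm ((real m)\<^sup>2) (f z) (snd p)" for m :: nat and p :: "nat \<times> ('n option, 'k fls) mvec" and z
  define A where "A m = {z \<in> Bl k x. \<not> marked comparable (psi m) (exp (- real m)) \<rho> rational_subspaces z}" for m
  define c where "c m = ennreal (C * (exp (- real m) / \<rho>) powr \<alpha>)" for m :: nat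
  \<comment> \<open>The ranks are the dimensions 0 to n + 1, hence n + 2 rounds of the
    induction.\<close>
  define K where "K = (of_nat (nondiv_const CARD('k ^ 'd) (card {..CARD('n option)})) :: ennreal)"
  have "((\<lambda>m. C * (exp (- real m) / \<rho>) powr \<alpha>) \<longlongrightarrow> 0) sequentially"
  proof -
    have eq: "C * (exp (- real m) / \<rho>) powr \<alpha> = C * (1 / \<rho>) powr \<alpha> * exp (- \<alpha>) ^ m" for m :: nat
    proof -
      have "(exp (- real m) / \<rho>) powr \<alpha> = exp (- real m) powr \<alpha> * (1 / \<rho>) powr \<alpha>"
        using \<rho>(1) powr_mult[of "exp (- real m)" "1 / \<rho>" \<alpha>] by simp
      also have "exp (- real m) powr \<alpha> = exp (- \<alpha>) ^ m"
        by (simp add: powr_def mult.commute flip: exp_of_nat_mult)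
      finally show ?thesis by simp
    qed
    have "((\<lambda>m. C * (1 / \<rho>) powr \<alpha> * exp (- \<alpha>) ^ m) \<longlongrightarrow> C * (1 / \<rho>) powr \<alpha> * 0) sequentially"
      using \<alpha> by (intro tendsto_mult_left LIMSEQ_power_zero) simp
    then show ?thesis by (simp only: eq mult_zero_right)
  qed
  then have "(\<lambda>m. ennreal (C * (exp (- real m) / \<rho>) powr \<alpha>)) \<longlonglongrightarrow> ennreal 0"
    by (rule tendsto_ennrealI)
  then have lim: "c \<longlonglongrightarrow> 0" by (simp add: c_def[abs_def])
  \<comment> \<open>Only for large m is \<open>c m\<close> below 1, as the density argument inside
    \<open>nondivergence\<close> requires.\<close>
  have ev: "eventually (\<lambda>m. outer_measure_of \<mu> (A m) \<le> K * c m * emeasure \<mu> (Bl k x)) sequentially"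
    using order_tendstoD(2)[OF lim zero_less_one]
  proof eventually_elim
    case (elim m)
    show ?case
      unfolding A_def K_def
    proof (rule nondivergence[where P = rational_subspaces and rk = fst and ?k0.0 = k and ?x0.0 = x])
      show "comparable p p" "comparable p q \<Longrightarrow> comparable q p"
        for p q :: "nat \<times> ('n option, 'k fls) mvec" by (auto simp: comparable_def)
      show "psi m p = psi m q"
        if "p \<in> rational_subspaces" "q \<in> rational_subspaces" "comparable p q" "fst p = fst q" for p q
        using wnorm_eq_if_comparable[OF that] by (simp add: psi_def fun_eq_iff)
      show "countable (rational_subspaces :: (nat \<times> ('n option, 'k fls) mvec) set)"
        by (rule countable_rational_subspaces)
      show "c m < 1" by fact
      show "outer_measure_of \<mu> {z \<in> Bl l y. psi m p z < exp (- real m)} \<le> c m * emeasure \<mu> (Bl l y)"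
        if l: "p \<in> rational_subspaces" "Bl l y \<subseteq> Bl k x" "\<exists>z\<in>Bl l y. \<rho> \<le> psi m p z" for p l y
      proof -
        obtain z where z: "z \<in> Bl l y" "\<rho> \<le> psi m p z" using l(3) by blast
        show ?thesis
          unfolding psi_def c_def
          by (rule wnorm_good[OF good C \<alpha> U(1) _ z(1) z(2)[unfolded psi_def] \<rho>(1)])
            (use l(2) U(2) in auto)
      qed
      show "\<exists>y\<in>Bl k x. \<rho> \<le> psi m p y" if "p \<in> rational_subspaces" for p
      proof -
        have "range (snd p) \<subseteq> intg" "snd p \<noteq> (\<lambda>_. 0)"
          using that by (auto simp: rational_subspaces_def)
        moreover have "Bl k x \<noteq> {}" using center_in_Bl by blast
        ultimately show ?thesis
          unfolding psi_def using wnorm_lower_bound[OF \<rho>(2) _ \<rho>(3)] by auto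
      qed
      show "fst ` (rational_subspaces :: (nat \<times> ('n option, 'k fls) mvec) set) \<subseteq> {..CARD('n option)}"
      proof (rule image_subsetI)
        fix p :: "nat \<times> ('n option, 'k fls) mvec"
        assume "p \<in> rational_subspaces"
        then have "fst p \<le> CARD('n option)"
          by (intro dec_le_card[of _ "snd p"]) (auto simp: rational_subspaces_def)
        then show "fst p \<in> {..CARD('n option)}" by simp
      qed
    qed auto
  qed
  have "K < top" unfolding K_def by (rule of_nat_less_top)
  then have "(\<lambda>m. K * c m * emeasure \<mu> (Bl k x)) \<longlonglongrightarrow> K * 0 * emeasure \<mu> (Bl k x)"
    using emeasure_Bl_finite[of k x]
    by (intro tendsto_mult_ennreal tendsto_const lim) auto
  then have lim': "(\<lambda>m. K * c m * emeasure \<mu> (Bl k x)) \<longlonglongrightarrow> 0" by simp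
  have "outer_measure_of \<mu> (\<Inter>m\<in>{M..}. A m) = 0" for M
  proof -
    have "outer_measure_of \<mu> (\<Inter>m\<in>{M..}. A m) \<le> 0"
    proof (rule tendsto_lowerbound[OF lim'])
      show "\<forall>\<^sub>F m in sequentially. outer_measure_of \<mu> (\<Inter>m\<in>{M..}. A m) \<le> K * c m * emeasure \<mu> (Bl k x)"
        using ev eventually_ge_at_top[of M]
      proof eventually_elim
        case (elim m)
        have "outer_measure_of \<mu> (\<Inter>m\<in>{M..}. A m) \<le> outer_measure_of \<mu> (A m)"
          using elim(2) by (intro outer_measure_of_mono) auto
        then show ?case using elim(1) by (rule order_trans)
      qed
    qed simp
    then show ?thesis by simp
  qed
  then have null: "outer_measure_of \<mu> (\<Union>M. \<Inter>m\<in>{M..}. A m) = 0"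
    by (intro outer_measure_of_UN_eq_0[OF space_haar]) auto
  \<comment> \<open>A point outside \<open>A m\<close> for infinitely many m has exponent at least
    1, so a bad point lies in all \<open>A m\<close> from some M on; such a tail is contained in
    single sets of arbitrarily small outer measure.\<close>
  have "{z \<in> Bl k x. \<not> 1 \<le> inhom_exponent (f z) \<theta>} \<subseteq> (\<Union>M. \<Inter>m\<in>{M..}. A m)"
  proof (rule subsetI, rule ccontr)
    fix z assume z: "z \<in> {z \<in> Bl k x. \<not> 1 \<le> inhom_exponent (f z) \<theta>}" "z \<notin> (\<Union>M. \<Inter>m\<in>{M..}. A m)"
    have "1 \<le> inhom_exponent (f z) \<theta>"
    proof (rule inhom_exponent_ge_1, unfold frequently_sequentially, rule allI)
      fix M
      obtain m where m: "M \<le> m" "z \<notin> A m" using z(2) by auto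
      then have mk: "marked comparable (\<lambda>p z. wnorm ((real m)\<^sup>2) (f z) (snd p)) (exp (- real m)) \<rho> rational_subspaces z"
        using z(1) unfolding A_def psi_def[abs_def] by auto
      have False
        if a: "a \<noteq> 0" "fabs (of_poly a) < exp (real CARD('n) * (real m)\<^sup>2 - real m)"
          and b: "\<forall>i. fabs (of_poly a * vec_nth (f z) i + of_poly (b i)) < exp (- ((real m)\<^sup>2 + real m))"
        for a :: "'k poly" and b :: "'n \<Rightarrow> 'k poly"
      proof (rule no_short_vector_if_marked[OF mk \<rho>(2), of "case_option (of_poly a) (\<lambda>i. of_poly (b i))"])
        show "case_option (of_poly a) (\<lambda>i. of_poly (b i)) \<noteq> (\<lambda>_. 0)"
          using a(1) by (metis of_poly_eq_0_iff option.simps(4))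
        show "range (case_option (of_poly a) (\<lambda>i. of_poly (b i))) \<subseteq> intg"
          by (auto simp: intg_def split: option.split)
        show "wt1 ((real m)\<^sup>2) i * fabs (case_option (of_poly a) (\<lambda>i. of_poly (b i)) i +
            case_option (of_poly a) (\<lambda>i. of_poly (b i)) None * ext0 (f z) i) < exp (- real m)" for i
        proof (cases i)
          case None
          have "exp (- (real CARD('n) * (real m)\<^sup>2)) * fabs (of_poly a)
              < exp (- (real CARD('n) * (real m)\<^sup>2)) * exp (real CARD('n) * (real m)\<^sup>2 - real m)"
            by (intro mult_strict_left_mono a(2)) simp
          then show ?thesis using None by (simp add: wt1_def flip: exp_add)
        next
          case (Some l)
          have "exp ((real m)\<^sup>2) * fabs (of_poly a * vec_nth (f z) l + of_poly (b l))
              < exp ((real m)\<^sup>2) * exp (- ((real m)\<^sup>2 + real m))"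
            by (intro mult_strict_left_mono b[rule_format]) simp
          then show ?thesis using Some by (simp add: wt1_def add.commute flip: exp_add)
        qed
      qed simp
      then show "\<exists>m\<ge>M. \<forall>(a :: 'k poly) (b :: 'n \<Rightarrow> 'k poly). a \<noteq> 0 \<longrightarrow>
          fabs (of_poly a) < exp (real CARD('n) * (real m)\<^sup>2 - real m) \<longrightarrow>
          \<not> (\<forall>i. fabs (of_poly a * vec_nth (f z) i + of_poly (b i)) < exp (- ((real m)\<^sup>2 + real m)))"
        using m(1) by blast
    qed
    then show False using z(1) by blast
  qed
  from outer_measure_of_mono[OF this, of \<mu>] null show ?thesis by simp
qed

end

theorem theorem1p2:
  fixes \<mu> :: "(('k::{field,finite} fls) ^ 'd) measure"
    and U :: "(('k fls) ^ 'd) set"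
    and f :: "('k fls) ^ 'd \<Rightarrow> ('k fls) ^ 'n"
    and C \<alpha>0 :: real
  assumes "is_haar \<mu>"
    and "open U"
    and "C > 0" and "\<alpha>0 > 0"
    and "good_map \<mu> C \<alpha>0 U f"
    and "nonplanar \<mu> U f"
  shows "\<forall>\<theta> :: 'k fls. AE x in \<mu>. x \<in> U \<longrightarrow> inhom_exponent (f x) \<theta> \<ge> 1"
proof
  fix \<theta> :: "'k fls"
  interpret haar_measure \<mu> by standard fact
  define indep where "indep B \<longleftrightarrow> (\<forall>c0 c. (\<forall>z\<in>B. affine_comb c0 c f z = 0) \<longrightarrow> c0 = 0 \<and> c = 0)" for B
  \<comment> \<open>A countable family of balls covers almost all of U: a nonplanar point lies in U
    together with a small ball centered at it, and on that ball the functions are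
    independent.\<close>
  define X where "X = {B. (\<exists>k x. B = Bl k x) \<and> B \<subseteq> U \<and> indep B}"
  have "countable X"
    by (rule countable_subset[OF _ countable_balls]) (auto simp: X_def)
  have "outer_measure_of \<mu> {z \<in> B. \<not> 1 \<le> inhom_exponent (f z) \<theta>} = 0" if "B \<in> X" for B
  proof -
    from \<open>B \<in> X\<close> obtain k x where B: "B = Bl k x" "B \<subseteq> U" "indep B" by (auto simp: X_def)
    show ?thesis
      unfolding B(1)
      by (rule exponent_in_ball[OF assms(5,3,4,2)]) (use B in \<open>auto simp: indep_def\<close>)
  qed
  then have "outer_measure_of \<mu> (\<Union>B\<in>X. {z \<in> B. \<not> 1 \<le> inhom_exponent (f z) \<theta>}) = 0"
    by (rule outer_measure_of_UN_eq_0[OF space_haar \<open>countable X\<close>])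
  then obtain N where N: "N \<in> null_sets \<mu>" "(\<Union>B\<in>X. {z \<in> B. \<not> 1 \<le> inhom_exponent (f z) \<theta>}) \<subseteq> N"
    using outer_measure_of_eq_0_iff[OF space_haar] by blast
  have "AE x in \<mu>. x \<in> U \<longrightarrow> nonplanar_at U f x" using assms(6) by (simp add: nonplanar_def)
  then show "AE x in \<mu>. x \<in> U \<longrightarrow> inhom_exponent (f x) \<theta> \<ge> 1"
    using AE_not_in[OF N(1)]
  proof eventually_elim
    case (elim x)
    show ?case
    proof
      assume "x \<in> U"
      then obtain n where n: "Bl (0 + int n) x \<subseteq> U" using assms(2) open_iff_Bl by blast
      have "\<forall>c0 c. (\<forall>z\<in>Bl (0 + int n) x. affine_comb c0 c f z = 0) \<longrightarrow> c0 = 0 \<and> c = 0"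
        using elim(1) \<open>x \<in> U\<close> n exp_gt_zero unfolding nonplanar_at_def Bl_eq_supball by blast
      then have "Bl (0 + int n) x \<in> X" using n unfolding X_def indep_def by blast
      then show "inhom_exponent (f x) \<theta> \<ge> 1"
        using N(2) elim(2) center_in_Bl[of x "0 + int n"] by blast
    qed
  qed
qed

end
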